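(* Let $A\in\mathbb{R}^{n\times d}$, $C\in\mathbb{R}^{n\times d_C}$, $U\in\mathbb{R}^{n_R\times d_C}$ and $R\in\mathbb{R}^{n_R\times d}$, and let $k$ be an integer with $0\le k\le\mathrm{rank}(U)$. Then the set of polynomials $$\mathcal{P}_k=\big\{p_{S,W}(x;A,C,U,R)\big\}_{S\in\binom{[n_R]}{k},\,W\in\binom{[d_C]}{k}}$$ forms a generalized interlacing family.
   Context: Notation: $[m]=\{1,\dots,m\}$; $\binom{[m]}{k}$ is the set of $k$-subsets of $[m]$. For a matrix $M$, $M_{S,W}$ is the submatrix with rows in $S$ and columns in $W$; $M_{:,W}$ keeps all rows, $M_{S,:}$ keeps all columns. For $S\in\binom{[n_R]}{k}$, $W\in\binom{[d_C]}{k}$, $$p_{S,W}(x;A,C,U,R):=(-1)^{d-k}\det\begin{bmatrix} I_n & 0 & C_{:,W} & A\\ 0 & 0 & U_{S,W} & R_{S,:}\\ (C_{:,W})^T & (U_{S,W})^T & 0 & 0\\ A^T & (R_{S,:})^T & 0 & -x I_d\end{bmatrix}.$$ $\lambda_i(f)$ is the $i$-th largest root of a real-rooted polynomial. Interlacing: let $f,g$ be real-rooted with positive leading coefficients, $\deg f=m$. We say $f$ interlaces $g$ if $\deg g\in\{m,m-1\}$ and: if $\deg g=m$, then $\lambda_1(f)\ge\lambda_1(g)\ge\lambda_2(f)\ge\lambda_2(g)\ge\cdots\ge\lambda_m(f)\ge\lambda_m(g)$; if $\deg g=m-1$, then $\lambda_1(f)\ge\lambda_1(g)\ge\lambda_2(f)\ge\cdots\ge\lambda_{m-1}(f)\ge\lambda_{m-1}(g)\ge\lambda_m(f)$.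 Real-rooted polynomials with positive leading coefficients have a common interlacing if some polynomial $f$ interlaces every one of them. Generalized interlacing family: a finite rooted tree $T$ together with a labelling of each node $v$ by a polynomial $f_v(x)\in\mathbb{R}[x]$ that is either identically zero or real-rooted with positive leading coefficient (a positive constant counts as real-rooted), such that (i) for every non-leaf node $v$, $f_v$ is a convex combination of the polynomials labelling its children; (ii) the degree of the root label $f_\emptyset$ equals the maximal degree of the polynomials labelling the leaf nodes; (iii) for any non-leaf node $v$ with $\deg(f_v)=\deg(f_\emptyset)$, the nonzero polynomials labelling the children of $v$ have degree $\deg(f_\emptyset)$ or $\deg(f_\emptyset)-1$, and they have a common interlacing. A set of polynomials forms a generalized interlacing family if it is the set of polynomials labelling the leaf nodes of such a tree. *)

theory Defs
  imports
    "HOL-Library.Extended_Real"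
    "HOL-Computational_Algebra.Polynomial"
    "Jordan_Normal_Form.Determinant"
    "Jordan_Normal_Form.DL_Submatrix"
    "Jordan_Normal_Form.DL_Rank"
begin

section \<open>Real-rooted polynomials and interlacing\<close>

definition real_rooted :: "real poly \<Rightarrow> bool" where
  "real_rooted p \<longleftrightarrow>
     p \<noteq> 0 \<and> (\<forall>z::complex. poly (map_poly complex_of_real p) z = 0 \<longrightarrow> z \<in> \<real>)"

definition real_rooted_pos :: "real poly \<Rightarrow> bool" where
  "real_rooted_pos p \<longleftrightarrow> real_rooted p \<and> lead_coeff p > 0"

text \<open>The \<open>i\<close>-th largest real root, counted with multiplicity; meaningful for
  \<open>1 \<le> i \<le> degree p\<close> when \<open>p\<close> is real-rooted.\<close>

definition ith_largest_root :: "nat \<Rightarrow> real poly \<Rightarrow> real" where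
  "ith_largest_root i p = rev (sorted_list_of_multiset (proots p)) ! (i - 1)"

definition interlaces :: "real poly \<Rightarrow> real poly \<Rightarrow> bool" where
  "interlaces f g \<longleftrightarrow>
     real_rooted_pos f \<and> real_rooted_pos g \<and>
     ((degree g = degree f \<and>
       (\<forall>i\<in>{1..degree f}. ith_largest_root i f \<ge> ith_largest_root i g) \<and>
       (\<forall>i\<in>{1..<degree f}. ith_largest_root i g \<ge> ith_largest_root (i + 1) f))
      \<or>
      (degree g + 1 = degree f \<and>
       (\<forall>i\<in>{1..<degree f}. ith_largest_root i f \<ge> ith_largest_root i g \<and> ith_largest_root i g \<ge> ith_largest_root (i + 1) f)))"

definition have_common_interlacing :: "real poly set \<Rightarrow> bool" where
  "have_common_interlacing F \<longleftrightarrow> (\<exists>f. \<forall>g\<in>F. interlaces f g)"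

section \<open>Generalized interlacing families\<close>

text \<open>The library degree of the zero polynomial is \<open>0\<close>; here labels may be zero, and the zero
  polynomial must not be confused with a nonzero constant, so its degree is taken to be
  \<open>-\<infinity>\<close>.\<close>

definition ext_degree :: "real poly \<Rightarrow> ereal" where
  "ext_degree p = (if p = 0 then -\<infinity> else ereal (real (degree p)))"

datatype ltree = Node (label: "real poly") (children: "ltree list")

text \<open>All subtrees of a tree, the tree itself included; they stand for the nodes, each with
  its label and its children.\<close>

primrec nodes :: "ltree \<Rightarrow> ltree set" where
  "nodes (Node f ts) = insert (Node f ts) (\<Union> (set (map nodes ts)))"

definition is_leaf :: "ltree \<Rightarrow> bool" where
  "is_leaf v \<longleftrightarrow> children v = []"

definition leaf_labels :: "ltree \<Rightarrow> real poly set" where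
  "leaf_labels T = label ` {v \<in> nodes T. is_leaf v}"

definition child_labels :: "ltree \<Rightarrow> real poly set" where
  "child_labels v = label ` set (children v)"

definition convex_combination :: "real poly \<Rightarrow> real poly list \<Rightarrow> bool" where
  "convex_combination f gs \<longleftrightarrow>
     (\<exists>w :: nat \<Rightarrow> real. (\<forall>i<length gs. 0 \<le> w i) \<and> (\<Sum>i<length gs. w i) = 1 \<and>
        f = (\<Sum>i<length gs. Polynomial.smult (w i) (gs ! i)))"

definition generalized_interlacing_tree :: "ltree \<Rightarrow> bool" where
  "generalized_interlacing_tree T \<longleftrightarrow>
     (\<forall>v\<in>nodes T. label v = 0 \<or> real_rooted_pos (label v)) \<and>
     (\<forall>v\<in>nodes T. \<not> is_leaf v \<longrightarrow> convex_combination (label v) (map label (children v))) \<and>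
     ext_degree (label T) = Max (ext_degree ` leaf_labels T) \<and>
     (\<forall>v\<in>nodes T. \<not> is_leaf v \<and> ext_degree (label v) = ext_degree (label T) \<longrightarrow>
        (\<forall>g \<in> child_labels v - {0}. ext_degree g = ext_degree (label T) \<or> ext_degree g = ext_degree (label T) - 1) \<and>
        have_common_interlacing (child_labels v - {0}))"

definition generalized_interlacing_family :: "real poly set \<Rightarrow> bool" where
  "generalized_interlacing_family P \<longleftrightarrow>
     (\<exists>T. generalized_interlacing_tree T \<and> P = leaf_labels T)"

section \<open>The polynomials \<open>p\<^sub>S\<^sub>,\<^sub>W\<close>\<close>

definition const_mat :: "real mat \<Rightarrow> real poly mat" where
  "const_mat M = map_mat (\<lambda>a. [:a:]) M"

text \<open>The \<open>4 \<times> 4\<close> block matrix, as a \<open>2 \<times> 2\<close> block matrix of \<open>2 \<times> 2\<close> block matrices,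
  with block sizes \<open>n, k, k, d\<close>. Rows and columns are numbered from \<open>0\<close>.\<close>

definition block_matrix ::
  "real mat \<Rightarrow> real mat \<Rightarrow> real mat \<Rightarrow> real mat \<Rightarrow> nat set \<Rightarrow> nat set \<Rightarrow> real poly mat" where
  "block_matrix A C U R S W =
    (let n = dim_row A; d = dim_col A; k = card S;
         CW = submatrix C UNIV W; USW = submatrix U S W; RS = submatrix R S UNIV
     in four_block_mat
          (const_mat (four_block_mat (1\<^sub>m n) (0\<^sub>m n k) (0\<^sub>m k n) (0\<^sub>m k k)))
          (const_mat (four_block_mat CW A USW RS))
          (const_mat (four_block_mat CW\<^sup>T USW\<^sup>T A\<^sup>T RS\<^sup>T))
          (four_block_mat (0\<^sub>m k k) (0\<^sub>m k d) (0\<^sub>m d k) ([:0, -1:] \<cdot>\<^sub>m 1\<^sub>m d)))"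

text \<open>The exponent \<open>d - k\<close> can be negative, hence the integer power.\<close>

definition p_poly ::
  "real mat \<Rightarrow> real mat \<Rightarrow> real mat \<Rightarrow> real mat \<Rightarrow> nat set \<Rightarrow> nat set \<Rightarrow> real poly" where
  "p_poly A C U R S W =
     Polynomial.smult ((-1) powi (int (dim_col A) - int (card S))) (det (block_matrix A C U R S W))"

definition k_subsets :: "nat \<Rightarrow> nat \<Rightarrow> nat set set" where
  "k_subsets m k = {S. S \<subseteq> {0..<m} \<and> card S = k}"

end

theory Submission
  imports Defs "HOL-Computational_Algebra.Fundamental_Theorem_Algebra" "Jordan_Normal_Form.Char_Poly"
begin

text \<open>
Up to the sign \<open>(-1) ^ (k + d)\<close>, the polynomial \<open>p\<^sub>S\<^sub>,\<^sub>W\<close> is a principal minor of one symmetric pencil,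
with an identity block of size \<open>n\<close>, one index for each row and each column of \<open>U\<close>, and a block
\<open>- x I\<close> of size \<open>d\<close>; the minor keeps the rows \<open>S\<close> and the columns \<open>W\<close> of \<open>U\<close>. The proof
rests on two properties of this pencil.

Stability: subtract \<open>z i\<close> from the diagonal entries outside the identity block, where \<open>z i = x\<close> on the
last block produces \<open>- x I\<close>. If every \<open>z i\<close> has positive imaginary part, the determinant is
nonzero (\<open>index_det_stable\<close>). Expanded in the variables of the rows and columns of \<open>U\<close>, this
determinant is a generating function for all minors (\<open>index_det_add_diag\<close>). Put \<open>z i = c i s\<close> on the rows and \<open>z j = c j t\<close> on the columns, with positive
\<open>c\<close>, differentiate in \<open>s\<close> and in \<open>t\<close>, which preserves the absence of zeros in the upper half-plane
by the Gauss--Lucas theorem, and let \<open>s\<close> and \<open>t\<close> tend to \<open>0\<close>. What remains is a positively weighted sum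
of the \<open>p\<^sub>S\<^sub>,\<^sub>W\<close> with prescribed sizes of \<open>S\<close> and \<open>W\<close>, and it is zero or real-rooted. The same holds
if some indices are forced into or out of \<open>S \<union> W\<close> (\<open>weighted_minors_real_rooted\<close>).

Sign: \<open>p\<^sub>S\<^sub>,\<^sub>W\<close> is nonnegative for positive \<open>x\<close> (\<open>sign_index_det_saddle\<close>), so leading terms never cancel in
sums, and the degree of an average is the maximal degree of its terms.

The tree decides the indices one by one, and a node carries the average of the polynomials that are
compatible with the decisions so far. By the weighted statement, every positive combination of the
labels of two siblings is zero or real-rooted. This implies a common interlacing and degrees that
differ by at most one (\<open>common_interlacing_pair\<close>): if \<open>f + \<mu> g\<close> has no zeros in the upper half-plane
for \<open>\<mu> > 0\<close>, then \<open>f / g\<close> avoids the negative reals there, so its argument stays between \<open>-\<pi>\<close> and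
\<open>\<pi>\<close>; close to a real point \<open>t\<close> this argument is \<open>\<pi>\<close> times the difference of the numbers of roots
of \<open>f\<close> and \<open>g\<close> above \<open>t\<close>.
\<close>

section \<open>Determinants over finite index sets\<close>

text \<open>
Principal minors for all subsets of one index type live side by side when the index set is an
argument; no renumbering of rows is needed when indices are deleted.
\<close>

definition index_det :: "'i set \<Rightarrow> ('i \<Rightarrow> 'i \<Rightarrow> 'a::comm_ring_1) \<Rightarrow> 'a" where
  "index_det T M = (\<Sum>p | p permutes T. of_int (sign p) * (\<Prod>i\<in>T. M i (p i)))"

lemma index_det_cong:
  assumes "\<And>i j. i \<in> T \<Longrightarrow> j \<in> T \<Longrightarrow> M i j = N i j"
  shows "index_det T M = index_det T N"
  unfolding index_det_def
  by (intro sum.cong refl arg_cong2[of _ _ _ _ "(*)"] prod.cong) (auto simp: assms permutes_in_image)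

text \<open>
The bridge to matrices: conjugating permutations by the enumeration \<open>f\<close> preserves signs.
\<close>

lemma det_mat_eq_index_det:
  assumes f: "bij_betw f {0..<N} T"
  shows "det (mat N N (\<lambda>(a, b). M (f a) (f b))) = index_det T M"
proof -
  have inj: "inj_on f {0..<N}" and im: "f ` {0..<N} = T"
    using f by (auto simp: bij_betw_def)
  have bij: "bij_betw (map_permutation {0..<N} f) {p. p permutes {0..<N}} {p. p permutes T}"
  proof (rule bij_betw_byWitness[where f' = "map_permutation T (inv_into {0..<N} f)"])
    have g: "bij_betw (inv_into {0..<N} f) T {0..<N}" by (rule bij_betw_inv_into[OF f])
    show "\<forall>p\<in>{p. p permutes {0..<N}}.
        map_permutation T (inv_into {0..<N} f) (map_permutation {0..<N} f p) = p"
      using f g inj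
      by (auto intro!: map_permutation_compose_inv simp: bij_betw_def)
    show "\<forall>p\<in>{p. p permutes T}.
        map_permutation {0..<N} f (map_permutation T (inv_into {0..<N} f) p) = p"
      using f g by (auto intro!: map_permutation_compose_inv simp: f_inv_into_f bij_betw_def)
    show "map_permutation {0..<N} f ` {p. p permutes {0..<N}} \<subseteq> {p. p permutes T}"
      using map_permutation_permutes[OF f] by auto
    show "map_permutation T (inv_into {0..<N} f) ` {p. p permutes T} \<subseteq> {p. p permutes {0..<N}}"
      using map_permutation_permutes[OF g] by auto
  qed
  have "index_det T M = (\<Sum>p | p permutes {0..<N}. of_int (sign (map_permutation {0..<N} f p)) *
      (\<Prod>i\<in>T. M i (map_permutation {0..<N} f p i)))"
    unfolding index_det_def by (rule sum.reindex_bij_betw[OF bij, symmetric])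
  also have "\<dots> = (\<Sum>p | p permutes {0..<N}. of_int (sign p) * (\<Prod>i\<in>{0..<N}. M (f i) (f (p i))))"
  proof (rule sum.cong[OF refl], goal_cases)
    case (1 p)
    have "(\<Prod>i\<in>T. M i (map_permutation {0..<N} f p i)) =
        (\<Prod>i\<in>{0..<N}. M (f i) (map_permutation {0..<N} f p (f i)))"
      by (rule prod.reindex_bij_betw[OF f, symmetric])
    also have "\<dots> = (\<Prod>i\<in>{0..<N}. M (f i) (f (p i)))"
      by (rule prod.cong) (auto simp: map_permutation_apply[OF inj])
    finally show ?case using 1 by (simp add: sign_map_permutation[OF inj])
  qed
  also have "\<dots> = det (mat N N (\<lambda>(a, b). M (f a) (f b)))"
    unfolding det_def
    by (auto intro!: sum.cong prod.cong simp: permutes_in_image)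
  finally show ?thesis by simp
qed

lemma index_det_eq_0_kernel:
  fixes M :: "'i \<Rightarrow> 'i \<Rightarrow> 'a::field"
  assumes "finite T" and "index_det T M = 0"
  obtains v where "\<exists>i\<in>T. v i \<noteq> 0" and "\<And>i. i \<in> T \<Longrightarrow> (\<Sum>j\<in>T. M i j * v j) = 0"
proof -
  obtain f where f: "bij_betw f {0..<card T} T"
    using ex_bij_betw_nat_finite[OF assms(1)] by blast
  define N g where "N = card T" and "g = inv_into {0..<card T} f"
  have gf: "g (f i) = i" if "i < N" for i
    using f that by (auto simp: g_def N_def bij_betw_def)
  let ?K = "mat N N (\<lambda>(a, b). M (f a) (f b))"
  have "det ?K = 0" using det_mat_eq_index_det[OF f, of M] assms(2) by (simp add: N_def)
  then obtain w where w: "w \<in> carrier_vec N" "w \<noteq> 0\<^sub>v N" "?K *\<^sub>v w = 0\<^sub>v N"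
    using det_0_iff_vec_prod_zero[of ?K N] by auto
  show ?thesis
  proof
    obtain a where a: "a < N" "w $ a \<noteq> 0"
      using w by (metis carrier_vecD eq_vecI index_zero_vec)
    have "f a \<in> T" using f a by (auto simp: bij_betw_def N_def)
    then show "\<exists>i\<in>T. w $ g i \<noteq> 0" using a gf by (intro bexI[of _ "f a"]) auto
    fix i assume "i \<in> T"
    then have "i \<in> f ` {0..<N}" using bij_betw_imp_surj_on[OF f] by (simp add: N_def)
    then obtain a where a: "a < N" "i = f a" by auto
    have "(\<Sum>j\<in>T. M i j * w $ g j) = (\<Sum>b\<in>{0..<N}. M i (f b) * w $ g (f b))"
      using sum.reindex_bij_betw[OF f, of "\<lambda>j. M i j * w $ g j"] by (simp add: N_def)
    also have "\<dots> = (?K *\<^sub>v w) $ a"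
      using w(1) a by (auto simp: scalar_prod_def gf intro!: sum.cong)
    finally show "(\<Sum>j\<in>T. M i j * w $ g j) = 0" using w(3) a by simp
  qed
qed

text \<open>
Only the permutations that fix \<open>j\<close> see the entry \<open>(j, j)\<close>, and these are the permutations of the
other indices.
\<close>

lemma index_det_add_diag_entry:
  assumes "finite T" "j \<notin> T"
  shows "index_det (insert j T) (\<lambda>a b. M a b + (if a = j \<and> b = j then z else 0)) =
    index_det (insert j T) M + z * index_det T M" (is "index_det _ ?N = _")
proof -
  let ?P = "{p. p permutes insert j T}" and ?J = "{p. p permutes T}"
  have fin: "finite ?P" using assms by (simp add: finite_permutations)
  have J: "?J = {p\<in>?P. p j = j}"
    using assms by (auto intro: permutes_subset permutes_superset simp: permutes_not_in)
  have "(\<Prod>i\<in>insert j T. ?N i (p i)) = (\<Prod>i\<in>insert j T. M i (p i)) +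
      (if p j = j then z * (\<Prod>i\<in>T. M i (p i)) else 0)" for p
  proof -
    have "(\<Prod>i\<in>T. ?N i (p i)) = (\<Prod>i\<in>T. M i (p i))"
      using assms by (intro prod.cong) auto
    then show ?thesis using assms by (auto simp: algebra_simps)
  qed
  then have "index_det (insert j T) ?N = index_det (insert j T) M +
      (\<Sum>p\<in>?P. if p j = j then z * (of_int (sign p) * (\<Prod>i\<in>T. M i (p i))) else 0)"
    unfolding index_det_def sum.distrib[symmetric]
    by (intro sum.cong) (auto simp: algebra_simps)
  also have "(\<Sum>p\<in>?P. if p j = j then z * (of_int (sign p) * (\<Prod>i\<in>T. M i (p i))) else 0) =
      z * index_det T M"
    unfolding index_det_def J sum_distrib_left using fin by (simp only: sum.inter_filter)
  finally show ?thesis .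
qed

text \<open>
A generating function for principal minors: as a polynomial in the diagonal shifts \<open>z j\<close> the
determinant is multiaffine, and its coefficients are the minors of the index sets between \<open>B\<close>
and \<open>B \<union> J\<close>.
\<close>

lemma index_det_add_diag:
  assumes "finite B" "finite J" "B \<inter> J = {}"
  shows "index_det (B \<union> J) (\<lambda>a b. M a b + (if a = b \<and> a \<in> J then z a else 0)) =
    (\<Sum>S\<in>Pow J. (\<Prod>j\<in>J - S. z j) * index_det (B \<union> S) M)"
  using assms(2,1,3)
proof (induction J arbitrary: B M rule: finite_induct)
  case (insert j J)
  let ?D = "\<lambda>a b. M a b + (if a = b \<and> a \<in> J then z a else 0)"
  have "index_det (B \<union> insert j J) (\<lambda>a b. M a b + (if a = b \<and> a \<in> insert j J then z a else 0)) =
      index_det (insert j (B \<union> J)) (\<lambda>a b. ?D a b + (if a = j \<and> b = j then z j else 0))"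
    using insert.hyps by (auto intro!: index_det_cong)
  also have "\<dots> = index_det (insert j B \<union> J) ?D + z j * index_det (B \<union> J) ?D"
    using insert.hyps insert.prems by (subst index_det_add_diag_entry) auto
  also have "index_det (B \<union> J) ?D = (\<Sum>S\<in>Pow J. (\<Prod>j\<in>J - S. z j) * index_det (B \<union> S) M)"
    using insert by auto
  also have "index_det (insert j B \<union> J) ?D =
      (\<Sum>S\<in>Pow J. (\<Prod>j\<in>J - S. z j) * index_det (insert j B \<union> S) M)"
    using insert.hyps insert.prems by (intro insert.IH) auto
  also have "\<dots> = (\<Sum>S\<in>insert j ` Pow J. (\<Prod>j\<in>insert j J - S. z j) * index_det (B \<union> S) M)"
    using insert.hyps
    by (subst sum.reindex)
       (auto simp: inj_on_def Un_commute intro!: sum.cong arg_cong2[of _ _ _ _ "(*)"] prod.cong)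
  also have "z j * (\<Sum>S\<in>Pow J. (\<Prod>j\<in>J - S. z j) * index_det (B \<union> S) M) =
      (\<Sum>S\<in>Pow J. (\<Prod>j\<in>insert j J - S. z j) * index_det (B \<union> S) M)"
    unfolding sum_distrib_left
  proof (rule sum.cong[OF refl])
    fix S assume "S \<in> Pow J"
    then have "insert j J - S = insert j (J - S)" using insert.hyps by auto
    then show "z j * ((\<Prod>j\<in>J - S. z j) * index_det (B \<union> S) M) =
        (\<Prod>j\<in>insert j J - S. z j) * index_det (B \<union> S) M"
      using insert.hyps by (simp add: algebra_simps)
  qed
  also have "(\<Sum>S\<in>insert j ` Pow J. (\<Prod>j\<in>insert j J - S. z j) * index_det (B \<union> S) M) +
      (\<Sum>S\<in>Pow J. (\<Prod>j\<in>insert j J - S. z j) * index_det (B \<union> S) M) =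
      (\<Sum>S\<in>Pow (insert j J). (\<Prod>j\<in>insert j J - S. z j) * index_det (B \<union> S) M)"
    using insert.hyps unfolding Pow_insert
    by (subst sum.union_disjoint) (auto simp: add.commute)
  finally show ?case .
qed simp

lemma index_det_diagonal:
  assumes "finite T"
  shows "index_det T (\<lambda>i j. if i = j then c i else 0) = (\<Prod>i\<in>T. c i)"
proof -
  have "index_det T (\<lambda>i j. if i = j then c i else 0) =
      (\<Sum>p | p permutes T. if p = id then (\<Prod>i\<in>T. c i) else 0)"
    unfolding index_det_def
  proof (rule sum.cong[OF refl], goal_cases)
    case (1 p)
    show ?case
    proof (cases "p = id")
      case False
      then obtain i where i: "p i \<noteq> i" by (auto simp: fun_eq_iff)
      with 1 have "i \<in> T" by (auto dest: permutes_not_in)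
      then have "(\<Prod>i\<in>T. if i = p i then c i else 0) = 0"
        using assms i by (intro prod_zero[OF _ bexI[of _ i]]) auto
      then show ?thesis using False by simp
    qed auto
  qed
  then show ?thesis using assms by (simp add: finite_permutations permutes_id)
qed

lemma poly_index_det: "poly (index_det T M) x = index_det T (\<lambda>i j. poly (M i j) x)"
  by (simp add: index_det_def poly_sum poly_prod)

lemma degree_index_det_le:
  assumes "finite T" and "\<And>i j. degree (M i j) \<le> 1"
  shows "degree (index_det T M) \<le> card T"
proof -
  have "degree (of_int (sign p) * (\<Prod>i\<in>T. M i (p i))) \<le> card T" for p
  proof -
    have "degree (\<Prod>i\<in>T. M i (p i)) \<le> (\<Sum>i\<in>T. degree (M i (p i)))"
      using degree_prod_sum_le[OF assms(1)] by (simp add: o_def)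
    also have "\<dots> \<le> card T" using sum_mono[of T "\<lambda>i. degree (M i (p i))" "\<lambda>_. 1"] assms(2) by simp
    finally show ?thesis by (cases p rule: sign_cases) auto
  qed
  then show ?thesis unfolding index_det_def using assms(1)
    by (intro degree_sum_le) (auto simp: finite_permutations)
qed

section \<open>Zeros and signs of symmetric pencils\<close>

text \<open>
Let \<open>v\<close> be in the kernel of \<open>M - diag z\<close>. Since \<open>M\<close> is real symmetric, \<open>v\<^sup>* M v\<close> is real, so the
imaginary part of \<open>v\<^sup>* diag z v = v\<^sup>* M v\<close> vanishes; it is the sum of \<open>Im (z i) |v i|\<^sup>2\<close> over \<open>E\<close>,
which forces \<open>v = 0\<close> on \<open>E\<close>. On \<open>B\<close> the matrix is the identity, which kills the rest of \<open>v\<close>.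
\<close>

lemma index_det_stable:
  fixes M :: "'i \<Rightarrow> 'i \<Rightarrow> real"
  assumes fin: "finite B" "finite E" and disj: "B \<inter> E = {}"
    and symm: "\<And>i j. M i j = M j i"
    and unit: "\<And>i j. i \<in> B \<Longrightarrow> j \<in> B \<Longrightarrow> M i j = (if i = j then 1 else 0)"
    and z: "\<And>i. i \<in> E \<Longrightarrow> Im (z i) > 0"
  shows "index_det (B \<union> E)
      (\<lambda>i j. complex_of_real (M i j) + (if i = j \<and> i \<in> E then - z i else 0)) \<noteq> 0"
proof
  let ?K = "\<lambda>i j. complex_of_real (M i j) + (if i = j \<and> i \<in> E then - z i else 0)"
  let ?T = "B \<union> E"
  assume "index_det ?T ?K = 0"
  then obtain v where v0: "\<exists>i\<in>?T. v i \<noteq> 0"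
    and v: "\<And>i. i \<in> ?T \<Longrightarrow> (\<Sum>j\<in>?T. ?K i j * v j) = 0"
    using index_det_eq_0_kernel[of ?T ?K] fin by blast
  have row: "(\<Sum>j\<in>?T. complex_of_real (M i j) * v j) = (if i \<in> E then z i * v i else 0)"
    if "i \<in> ?T" for i
  proof -
    have "(\<Sum>j\<in>?T. ?K i j * v j) = (\<Sum>j\<in>?T. complex_of_real (M i j) * v j) +
        (\<Sum>j\<in>?T. if i = j then (if i \<in> E then - z i * v i else 0) else 0)"
      unfolding sum.distrib[symmetric] by (intro sum.cong) (auto simp: algebra_simps)
    then show ?thesis using v[OF that] that fin by (auto split: if_splits)
  qed
  have "(\<Sum>i\<in>E. z i * (cmod (v i))\<^sup>2) = (\<Sum>i\<in>?T. if i \<in> E then z i * (cmod (v i))\<^sup>2 else 0)"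
    using fin by (intro sum.mono_neutral_cong_left) auto
  also have "\<dots> = (\<Sum>i\<in>?T. cnj (v i) * (\<Sum>j\<in>?T. complex_of_real (M i j) * v j))"
  proof (rule sum.cong[OF refl])
    fix i assume "i \<in> ?T"
    show "(if i \<in> E then z i * (cmod (v i))\<^sup>2 else 0) =
        cnj (v i) * (\<Sum>j\<in>?T. complex_of_real (M i j) * v j)"
      unfolding row[OF \<open>i \<in> ?T\<close>] by (simp add: complex_norm_square mult_ac del: of_real_power)
  qed
  also have "\<dots> = (\<Sum>i\<in>?T. \<Sum>j\<in>?T. complex_of_real (M i j) * (cnj (v i) * v j))" (is "_ = ?Q")
    by (simp add: sum_distrib_left algebra_simps)
  finally have Q: "(\<Sum>i\<in>E. z i * (cmod (v i))\<^sup>2) = ?Q" .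
  have "cnj ?Q = (\<Sum>i\<in>?T. \<Sum>j\<in>?T. complex_of_real (M j i) * (cnj (v j) * v i))"
    by (simp add: symm algebra_simps)
  also have "\<dots> = ?Q" by (rule sum.swap)
  finally have "Im (cnj ?Q) = Im ?Q" by (simp only:)
  then have "Im ?Q = 0" unfolding cnj.sel by linarith
  then have "(\<Sum>i\<in>E. Im (z i) * (cmod (v i))\<^sup>2) = 0"
    unfolding Q[symmetric] by simp
  then have "\<forall>i\<in>E. Im (z i) * (cmod (v i))\<^sup>2 = 0"
    using fin z by (subst (asm) sum_nonneg_eq_0_iff) (auto intro: mult_nonneg_nonneg[OF less_imp_le])
  then have vE: "v i = 0" if "i \<in> E" for i using z[OF that] that by auto
  have "v i = 0" if "i \<in> B" for i
  proof -
    have "(\<Sum>j\<in>?T. complex_of_real (M i j) * v j) = (\<Sum>j\<in>B. if j = i then v i else 0)"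
      using fin that by (intro sum.mono_neutral_cong_right) (auto simp: unit vE)
    also have "\<dots> = v i" using fin that by simp
    finally have "v i = (if i \<in> E then z i * v i else 0)" using row[of i] that by simp
    moreover have "i \<notin> E" using that disj by auto
    ultimately show ?thesis by simp
  qed
  with vE v0 show False by auto
qed

text \<open>
A saddle-point matrix: \<open>M\<close> is diagonal and nonnegative on \<open>P\<close>, diagonal and nonpositive on \<open>Q\<close>.
Multiplying the rows in \<open>Q\<close> by \<open>-1\<close> turns it into a matrix whose symmetric part is positive
semidefinite. Along the segment from the signature matrix \<open>diag \<sigma>\<close> to \<open>M\<close> this part is positive
definite until the endpoint, so the determinant cannot change sign before it.
\<close>

lemma sign_index_det_saddle:
  fixes M :: "'i \<Rightarrow> 'i \<Rightarrow> real"
  assumes fin: "finite P" "finite Q" and disj: "P \<inter> Q = {}"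
    and symm: "\<And>i j. M i j = M j i"
    and P: "\<And>i j. i \<in> P \<Longrightarrow> j \<in> P \<Longrightarrow> i \<noteq> j \<Longrightarrow> M i j = 0" "\<And>i. i \<in> P \<Longrightarrow> M i i \<ge> 0"
    and Q: "\<And>i j. i \<in> Q \<Longrightarrow> j \<in> Q \<Longrightarrow> i \<noteq> j \<Longrightarrow> M i j = 0" "\<And>i. i \<in> Q \<Longrightarrow> M i i \<le> 0"
  shows "(-1) ^ card Q * index_det (P \<union> Q) M \<ge> 0"
proof (rule ccontr)
  assume neg: "\<not> ?thesis"
  let ?T = "P \<union> Q"
  define \<sigma> :: "'i \<Rightarrow> real" where "\<sigma> i = (if i \<in> Q then -1 else 1)" for i
  define K where "K u i j = u * M i j + (1 - u) * (if i = j then \<sigma> i else 0)" for u i j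
  have K1: "K 1 = M" by (simp add: K_def fun_eq_iff)
  define h where "h u = (-1) ^ card Q * index_det ?T (K u)" for u
  have "continuous_on {0..1} h"
    unfolding h_def index_det_def K_def
    by (intro continuous_intros)
  moreover have "h 1 < 0" using neg K1 by (simp add: h_def)
  moreover have "h 0 = 1"
  proof -
    have "index_det ?T (K 0) = (\<Prod>i\<in>?T. \<sigma> i)"
    proof -
      have "K 0 = (\<lambda>i j. if i = j then \<sigma> i else 0)" by (simp add: K_def fun_eq_iff)
      then show ?thesis using index_det_diagonal[of ?T \<sigma>] fin by simp
    qed
    also have "\<dots> = (\<Prod>i\<in>P. \<sigma> i) * (\<Prod>i\<in>Q. \<sigma> i)"
      using fin disj by (rule prod.union_disjoint)
    also have "(\<Prod>i\<in>P. \<sigma> i) = 1" using disj by (intro prod.neutral) (auto simp: \<sigma>_def)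
    also have "(\<Prod>i\<in>Q. \<sigma> i) = (-1) ^ card Q" by (simp add: \<sigma>_def)
    finally show ?thesis by (simp add: h_def flip: power_mult_distrib)
  qed
  ultimately obtain u where u: "0 \<le> u" "u \<le> 1" "h u = 0"
    using IVT2'[of h 1 0 0] by auto
  have "u < 1" using u \<open>h 1 < 0\<close> by (cases "u = 1") auto
  have "index_det ?T (K u) = 0" using u by (simp add: h_def)
  then obtain v where v0: "\<exists>i\<in>?T. v i \<noteq> 0"
    and v: "\<And>i. i \<in> ?T \<Longrightarrow> (\<Sum>j\<in>?T. K u i j * v j) = 0"
    using index_det_eq_0_kernel[of ?T "K u"] fin by blast
  \<comment> \<open>The cross terms between \<open>P\<close> and \<open>Q\<close> cancel after symmetrization.\<close>
  let ?s = "\<Sum>i\<in>?T. \<Sum>j\<in>?T. \<sigma> i * M i j * v i * v j"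
  have "?s + ?s = ?s + (\<Sum>i\<in>?T. \<Sum>j\<in>?T. \<sigma> j * M j i * v j * v i)"
    by (rule arg_cong[of _ _ "\<lambda>x. ?s + x"]) (rule sum.swap)
  also have "\<dots> = (\<Sum>i\<in>?T. \<Sum>j\<in>?T. (\<sigma> i + \<sigma> j) * M i j * v i * v j)"
    unfolding sum.distrib[symmetric]
  proof (intro sum.cong refl)
    fix i j
    show "\<sigma> i * M i j * v i * v j + \<sigma> j * M j i * v j * v i = (\<sigma> i + \<sigma> j) * M i j * v i * v j"
      using symm[of j i] by (simp add: distrib_right)
  qed
  also have "\<dots> \<ge> 0"
  proof (intro sum_nonneg)
    fix i j assume ij: "i \<in> ?T" "j \<in> ?T"
    show "(\<sigma> i + \<sigma> j) * M i j * v i * v j \<ge> 0"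
    proof (cases "i = j")
      case True
      have "\<sigma> i * M i i \<ge> 0" using ij P(2) Q(2) by (auto simp: \<sigma>_def)
      then have "2 * (\<sigma> i * M i i) * (v i * v i) \<ge> 0" by simp
      then show ?thesis using True by (simp add: algebra_simps)
    next
      case False
      then show ?thesis using ij P(1) Q(1) by (auto simp: \<sigma>_def)
    qed
  qed
  finally have s: "?s \<ge> 0" by simp
  have "0 = (\<Sum>i\<in>?T. \<sigma> i * v i * (\<Sum>j\<in>?T. K u i j * v j))" by (simp add: v)
  also have "\<dots> = (\<Sum>i\<in>?T. \<Sum>j\<in>?T. u * (\<sigma> i * M i j * v i * v j) +
      (if i = j then (1 - u) * (v i)\<^sup>2 else 0))"
    unfolding sum_distrib_left
    by (intro sum.cong) (auto simp: K_def \<sigma>_def power2_eq_square algebra_simps)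
  also have "\<dots> = u * ?s + (1 - u) * (\<Sum>i\<in>?T. (v i)\<^sup>2)"
    using fin by (simp add: sum.distrib sum_distrib_left)
  finally have "(1 - u) * (\<Sum>i\<in>?T. (v i)\<^sup>2) \<le> 0" 
    using mult_nonneg_nonneg[OF u(1) s] by linarith
  moreover have "(\<Sum>i\<in>?T. (v i)\<^sup>2) > 0"
    using v0 fin by (auto intro: sum_pos2)
  ultimately show False using \<open>u < 1\<close> by (simp add: mult_le_0_iff)
qed

section \<open>Polynomials without zeros in the upper half-plane\<close>

definition upper_stable :: "complex poly \<Rightarrow> bool" where
  "upper_stable p \<longleftrightarrow> (\<forall>z. Im z > 0 \<longrightarrow> poly p z \<noteq> 0)"

lemma complex_poly_linear_factors:
  fixes p :: "complex poly"
  assumes "p \<noteq> 0"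
  obtains r where "\<And>z. poly p z = lead_coeff p * (\<Prod>i<degree p. z - r i)"
    and "\<And>i. i < degree p \<Longrightarrow> poly p (r i) = 0"
proof -
  obtain r where r: "smult (lead_coeff p) (\<Prod>i<degree p. [:- r i, 1:]) = p"
    by (rule complex_poly_decompose')
  have eq: "poly p z = lead_coeff p * (\<Prod>i<degree p. z - r i)" for z
    by (subst r[symmetric]) (simp add: poly_prod)
  show ?thesis
  proof (rule that[of r])
    show "poly p (r i) = 0" if "i < degree p" for i
      unfolding eq using that by auto
  qed (rule eq)
qed

text \<open>
Gauss and Lucas: in the upper half-plane the logarithmic derivative is the sum of \<open>1 / (z - r)\<close>
over the zeros \<open>r\<close>, and each term has negative imaginary part.
\<close>

lemma upper_stable_pderiv:
  assumes "upper_stable p" "degree p > 0"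
  shows "upper_stable (pderiv p)"
  unfolding upper_stable_def
proof (intro allI impI)
  fix z assume z: "Im z > 0"
  obtain root where root: "smult (lead_coeff p) (\<Prod>i<degree p. [:- root i, 1:]) = p"
    by (rule complex_poly_decompose')
  define q where "q = (\<Prod>i<degree p. [:- root i, 1:])"
  have p: "p = smult (lead_coeff p) q" using root by (simp add: q_def)
  have lc: "lead_coeff p \<noteq> 0" using assms(2) by auto
  have im: "Im (root i) \<le> 0" if "i < degree p" for i
  proof -
    have "poly q (root i) = 0" using that by (auto simp: q_def poly_prod)
    then have "poly p (root i) = 0" by (subst p) simp
    then show ?thesis using assms(1) by (force simp: upper_stable_def)
  qed
  have nz: "z - root i \<noteq> 0" if "i < degree p" for i using im[OF that] z by auto
  have "poly (pderiv q) z = (\<Sum>i<degree p. \<Prod>j\<in>{..<degree p} - {i}. z - root j)"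
    by (simp add: q_def pderiv_prod poly_sum poly_prod pderiv_pCons)
  also have "\<dots> = (\<Sum>i<degree p. (\<Prod>j<degree p. z - root j) * inverse (z - root i))"
  proof (intro sum.cong refl)
    fix i assume i: "i \<in> {..<degree p}"
    then have "(z - root i) * inverse (z - root i) = 1" using nz by (intro right_inverse) auto
    then show "(\<Prod>j\<in>{..<degree p} - {i}. z - root j) =
        (\<Prod>j<degree p. z - root j) * inverse (z - root i)"
      using i by (subst prod.remove[of _ i]) (auto simp: mult_ac)
  qed
  also have "\<dots> = (\<Prod>j<degree p. z - root j) * (\<Sum>i<degree p. inverse (z - root i))"
    by (simp add: sum_distrib_left)
  finally have "poly (pderiv p) z =
      lead_coeff p * ((\<Prod>j<degree p. z - root j) * (\<Sum>i<degree p. inverse (z - root i)))"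
    by (subst p) (simp add: pderiv_smult)
  moreover have "(\<Sum>i<degree p. inverse (z - root i)) \<noteq> 0"
  proof -
    have "Im (inverse (z - root i)) < 0" if "i < degree p" for i
    proof -
      have "(Re (z - root i))\<^sup>2 + (Im (z - root i))\<^sup>2 > 0"
        using nz[OF that] by (simp add: complex_eq_iff sum_power2_gt_zero_iff)
      then show ?thesis using im[OF that] z by (simp add: divide_neg_pos)
    qed
    then have "(\<Sum>i<degree p. Im (inverse (z - root i))) < 0"
      using sum_strict_mono[of "{..<degree p}" "\<lambda>i. Im (inverse (z - root i))" "\<lambda>_. 0"] assms(2)
      by auto
    then show ?thesis by (metis Im_sum less_irrefl zero_complex.sel(2))
  qed
  ultimately show "poly (pderiv p) z \<noteq> 0" using lc nz by auto
qed

lemma upper_stable_higher_pderiv: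
  assumes "upper_stable p" "m \<le> degree p"
  shows "upper_stable ((pderiv ^^ m) p)"
  using assms(2)
proof (induction m)
  case (Suc m)
  then show ?case by (auto intro!: upper_stable_pderiv simp: degree_higher_pderiv)
qed (simp add: assms(1))

text \<open>
A Harnack-type bound, proved factor by factor: \<open>|w - r| \<le> |w - z| + |z - r|\<close>, and \<open>|z - r| \<ge> Im z\<close>
because \<open>r\<close> is not in the upper half-plane.
\<close>

lemma upper_stable_growth:
  assumes "upper_stable p" "Im z > 0"
  shows "cmod (poly p w) \<le> (1 + cmod (w - z) / Im z) ^ degree p * cmod (poly p z)"
proof -
  have "p \<noteq> 0" using assms by (auto simp: upper_stable_def)
  then obtain r where r: "\<And>z. poly p z = lead_coeff p * (\<Prod>i<degree p. z - r i)"
    and r0: "\<And>i. i < degree p \<Longrightarrow> poly p (r i) = 0"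
    by (rule complex_poly_linear_factors) blast
  have "cmod (w - r i) \<le> (1 + cmod (w - z) / Im z) * cmod (z - r i)" if "i < degree p" for i
  proof -
    have "Im (r i) \<le> 0" using r0[OF that] assms(1) by (force simp: upper_stable_def)
    then have "Im z \<le> cmod (z - r i)" using abs_Im_le_cmod[of "z - r i"] by simp
    then have "cmod (w - z) \<le> cmod (w - z) / Im z * cmod (z - r i)"
      using assms(2) mult_left_mono[of "Im z" "cmod (z - r i)" "cmod (w - z) / Im z"] by simp
    moreover have "cmod (w - r i) \<le> cmod (w - z) + cmod (z - r i)"
      using norm_triangle_ineq[of "w - z" "z - r i"] by simp
    ultimately show ?thesis by (simp add: algebra_simps)
  qed
  then have "(\<Prod>i<degree p. cmod (w - r i)) \<le> (\<Prod>i<degree p. (1 + cmod (w - z) / Im z) * cmod (z - r i))"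
    by (intro prod_mono) auto
  then have "cmod (lead_coeff p) * (\<Prod>i<degree p. cmod (w - r i)) \<le>
      cmod (lead_coeff p) * ((1 + cmod (w - z) / Im z) ^ degree p * (\<Prod>i<degree p. cmod (z - r i)))"
    by (intro mult_left_mono) (auto simp: prod.distrib)
  then show ?thesis unfolding r[of w] r[of z]
    by (simp add: norm_mult prod_norm mult_ac)
qed

text \<open>
Hurwitz's theorem for polynomials of bounded degree, with pointwise convergence: a zero of the
limit in the upper half-plane makes the limit vanish everywhere, by the growth bound.
\<close>

lemma upper_stable_limit:
  assumes stable: "\<And>n. upper_stable (q n)" and deg: "\<And>n. degree (q n) \<le> N"
    and lim: "\<And>z. (\<lambda>n. poly (q n) z) \<longlonglongrightarrow> poly p z"
  shows "p = 0 \<or> upper_stable p"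
proof (cases "upper_stable p")
  case False
  then obtain z where z: "Im z > 0" "poly p z = 0" by (auto simp: upper_stable_def)
  have "poly p w = 0" for w
  proof -
    let ?c = "1 + cmod (w - z) / Im z"
    have c: "?c \<ge> 1" using z by simp
    have "(\<lambda>n. ?c ^ N * cmod (poly (q n) z)) \<longlonglongrightarrow> ?c ^ N * cmod (poly p z)"
      by (intro tendsto_intros lim)
    moreover have "(\<lambda>n. cmod (poly (q n) w)) \<longlonglongrightarrow> cmod (poly p w)"
      by (intro tendsto_intros lim)
    moreover have "cmod (poly (q n) w) \<le> ?c ^ N * cmod (poly (q n) z)" for n
      using upper_stable_growth[OF stable z(1), of n w] power_increasing[OF deg c, of n]
      by (meson mult_right_mono norm_ge_zero order_trans)
    ultimately have "cmod (poly p w) \<le> ?c ^ N * cmod (poly p z)"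
      by (intro LIMSEQ_le) auto
    then show ?thesis using z by simp
  qed
  then show ?thesis using poly_all_0_iff_0 by blast
qed simp

text \<open>
The polynomial \<open>\<Sum>S\<subseteq>J. g S (\<Prod>j\<in>J - S. c j s)\<close> in \<open>s\<close> results from a multiaffine polynomial in variables
\<open>z j\<close>, \<open>j \<in> J\<close>, by the substitution \<open>z j = c j s\<close>. Its coefficient of degree \<open>a\<close> collects the sets with
\<open>a\<close> missing elements, and is reached by differentiating \<open>a\<close> times and letting \<open>s\<close> tend to \<open>0\<close>.
\<close>

definition subset_poly :: "('i \<Rightarrow> complex) \<Rightarrow> 'i set \<Rightarrow> ('i set \<Rightarrow> complex) \<Rightarrow> complex poly" where
  "subset_poly c J g = (\<Sum>S\<in>Pow J. smult (g S) (monom (\<Prod>j\<in>J - S. c j) (card (J - S))))"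

text \<open>
The factor with which \<open>g S\<close> enters the \<open>a\<close>-th derivative of \<open>subset_poly c J g\<close> at \<open>s\<close>.
\<close>

definition deriv_weight :: "nat \<Rightarrow> ('i \<Rightarrow> complex) \<Rightarrow> 'i set \<Rightarrow> complex \<Rightarrow> 'i set \<Rightarrow> complex" where
  "deriv_weight a c J s S = poly ((pderiv ^^ a) (monom (\<Prod>j\<in>J - S. c j) (card (J - S)))) s"

lemma poly_subset_poly:
  "poly (subset_poly c J g) s = (\<Sum>S\<in>Pow J. (\<Prod>j\<in>J - S. c j * s) * g S)"
  by (simp add: subset_poly_def poly_sum poly_monom prod.distrib algebra_simps)

lemma poly_higher_pderiv_subset_poly:
  "poly ((pderiv ^^ a) (subset_poly c J g)) s = (\<Sum>S\<in>Pow J. deriv_weight a c J s S * g S)"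
  by (simp add: subset_poly_def deriv_weight_def higher_pderiv_sum higher_pderiv_smult poly_sum
      mult.commute)

lemma deriv_weight_0:
  "deriv_weight a c J 0 S = (if card (J - S) = a then fact a * (\<Prod>j\<in>J - S. c j) else 0)"
proof -
  have "deriv_weight a c J 0 S = pochhammer 1 a * coeff (monom (\<Prod>j\<in>J - S. c j) (card (J - S))) a"
    by (simp add: deriv_weight_def poly_0_coeff_0 coeff_higher_pderiv)
  then show ?thesis by (simp add: pochhammer_fact)
qed

text \<open>
The leading coefficient belongs to \<open>S = {}\<close>, so the condition on \<open>g {}\<close> fixes the degree at \<open>card J\<close>
and Gauss--Lucas applies \<open>a\<close> times.
\<close>

lemma deriv_weight_sum_nonzero:
  assumes J: "finite J" and c: "\<And>j. j \<in> J \<Longrightarrow> c j \<noteq> 0" and g: "g {} \<noteq> 0" and a: "a \<le> card J"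
    and nz: "\<And>s. Im s > 0 \<Longrightarrow> (\<Sum>S\<in>Pow J. (\<Prod>j\<in>J - S. c j * s) * g S) \<noteq> 0"
    and s: "Im s > 0"
  shows "(\<Sum>S\<in>Pow J. deriv_weight a c J s S * g S) \<noteq> 0"
proof -
  have "coeff (subset_poly c J g) (card J) = (\<Sum>S\<in>Pow J. if S = {} then g {} * (\<Prod>j\<in>J. c j) else 0)"
    unfolding subset_poly_def coeff_sum coeff_smult coeff_monom
  proof (rule sum.cong[OF refl])
    fix S assume S: "S \<in> Pow J"
    have "card (J - S) = card J \<longleftrightarrow> S = {}"
    proof
      assume "card (J - S) = card J"
      then have "J - S = J" using J by (intro card_subset_eq) auto
      then show "S = {}" using S by auto
    qed simp
    then show "g S * (if card (J - S) = card J then \<Prod>j\<in>J - S. c j else 0) =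
        (if S = {} then g {} * (\<Prod>j\<in>J. c j) else 0)" by simp
  qed
  also have "\<dots> \<noteq> 0" using J c g by simp
  finally have "a \<le> degree (subset_poly c J g)" using a le_degree le_trans by blast
  moreover have "upper_stable (subset_poly c J g)"
    using nz by (simp add: upper_stable_def poly_subset_poly)
  ultimately show ?thesis
    using upper_stable_higher_pderiv[of "subset_poly c J g" a] s
    by (simp add: upper_stable_def poly_higher_pderiv_subset_poly)
qed

text \<open>
The two-variable version, one variable at a time. Differentiating in one variable needs the
leading coefficient to be nonzero at every point of the half-plane in the other variable; these
coefficients are the same sums with \<open>J1\<close> or \<open>J2\<close> replaced by \<open>{}\<close>, whence the form of \<open>nz\<close>.
\<close>

lemma deriv_weight_double_sum_nonzero:
  assumes J: "finite J1" "finite J2" and c: "\<And>j. j \<in> J1 \<union> J2 \<Longrightarrow> c j \<noteq> 0"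
    and a: "a \<le> card J1" and b: "b \<le> card J2"
    and nz: "\<And>K1 K2 s t. K1 = J1 \<or> K1 = {} \<Longrightarrow> K2 = J2 \<or> K2 = {} \<Longrightarrow> Im s > 0 \<Longrightarrow> Im t > 0 \<Longrightarrow>
      (\<Sum>S\<in>Pow K1. (\<Prod>j\<in>K1 - S. c j * s) * (\<Sum>W\<in>Pow K2. (\<Prod>j\<in>K2 - W. c j * t) * g S W)) \<noteq> 0"
    and s: "Im s > 0" and t: "Im t > 0"
  shows "(\<Sum>S\<in>Pow J1. deriv_weight a c J1 s S * (\<Sum>W\<in>Pow J2. deriv_weight b c J2 t W * g S W)) \<noteq> 0"
proof (rule deriv_weight_sum_nonzero)
  show "(\<Sum>W\<in>Pow J2. deriv_weight b c J2 t W * g {} W) \<noteq> 0"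
  proof (rule deriv_weight_sum_nonzero)
    show "g {} {} \<noteq> 0" using nz[of "{}" "{}" s t] s t by simp
    show "(\<Sum>W\<in>Pow J2. (\<Prod>j\<in>J2 - W. c j * t) * g {} W) \<noteq> 0" if "Im t > 0" for t
      using nz[of "{}" J2 s t] s that by simp
  qed (use assms in auto)
  fix s assume s: "Im s > 0"
  have "(\<Sum>W\<in>Pow J2. deriv_weight b c J2 t W * (\<Sum>S\<in>Pow J1. (\<Prod>j\<in>J1 - S. c j * s) * g S W)) \<noteq> 0"
  proof (rule deriv_weight_sum_nonzero)
    show "(\<Sum>S\<in>Pow J1. (\<Prod>j\<in>J1 - S. c j * s) * g S {}) \<noteq> 0"
      using nz[of J1 "{}" s t] s t by simp
    fix t assume "Im t > 0"
    then show "(\<Sum>W\<in>Pow J2. (\<Prod>j\<in>J2 - W. c j * t) * (\<Sum>S\<in>Pow J1. (\<Prod>j\<in>J1 - S. c j * s) * g S W)) \<noteq> 0"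
      using nz[of J1 J2 s t] s unfolding sum_distrib_left
      by (subst sum.swap) (simp add: mult.left_commute)
  qed (use assms in auto)
  then show "(\<Sum>S\<in>Pow J1. (\<Prod>j\<in>J1 - S. c j * s) * (\<Sum>W\<in>Pow J2. deriv_weight b c J2 t W * g S W)) \<noteq> 0"
    unfolding sum_distrib_left by (subst sum.swap) (simp add: mult.left_commute)
qed (use assms in auto)

section \<open>Weighted sums of minors\<close>

interpretation of_real_poly_hom: map_poly_inj_idom_hom complex_of_real ..

abbreviation cpoly :: "real poly \<Rightarrow> complex poly" where
  "cpoly p \<equiv> map_poly complex_of_real p"

lemma index_det_tendsto:
  fixes K :: "'a \<Rightarrow> 'i \<Rightarrow> 'i \<Rightarrow> complex"
  assumes "\<And>i j. ((\<lambda>n. K n i j) \<longlongrightarrow> L i j) G"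
  shows "((\<lambda>n. index_det T (K n)) \<longlongrightarrow> index_det T L) G"
  unfolding index_det_def by (intro tendsto_intros assms)

definition minor_pencil :: "('i \<Rightarrow> 'i \<Rightarrow> real) \<Rightarrow> 'i set \<Rightarrow> 'i \<Rightarrow> 'i \<Rightarrow> real poly" where
  "minor_pencil M X i j = [:M i j:] - (if i = j \<and> i \<in> X then [:0, 1:] else 0)"

lemma real_rooted_of_upper_stable:
  assumes "upper_stable (cpoly p)"
  shows "real_rooted p"
proof -
  have "p \<noteq> 0" using assms by (auto simp: upper_stable_def dest: spec[of _ \<i>])
  moreover have "z \<in> \<real>" if "poly (cpoly p) z = 0" for z
  proof -
    have "poly (cpoly p) (cnj z) = 0"
      using that by (subst real_poly_cnj_root_iff) auto
    then have "\<not> Im z > 0" "\<not> Im (cnj z) > 0" using assms that unfolding upper_stable_def by blast+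
    then show ?thesis by (simp add: complex_is_Real_iff)
  qed
  ultimately show ?thesis by (simp add: real_rooted_def)
qed

text \<open>
The sum of the minors with prescribed numbers of indices missing from \<open>J1\<close> and \<open>J2\<close>, weighted by
\<open>c\<close> over the missing indices, is up to sign a coefficient of the generating function of
\<open>index_det_add_diag\<close> at \<open>z j = c j s\<close> on \<open>J1\<close> and \<open>z j = c j t\<close> on \<open>J2\<close>. That function has no
zeros for \<open>s\<close>, \<open>t\<close>, \<open>x\<close> in the upper half-plane, and extraction of the coefficient preserves
this. The stability argument needs every shift outside \<open>B\<close> strictly inside the half-plane, so the
indices in \<open>I\<close> are shifted by \<open>\<epsilon>\<close>; this \<open>\<epsilon>\<close> and the points \<open>s = t = \<epsilon>\<close> tend to \<open>0\<close>
together.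
\<close>

lemma weighted_minors_real_rooted:
  fixes M :: "'i \<Rightarrow> 'i \<Rightarrow> real" and c :: "'i \<Rightarrow> real"
  assumes fin: "finite B" "finite I" "finite X" "finite J1" "finite J2"
    and disj: "B \<inter> (I \<union> X \<union> J1 \<union> J2) = {}" "I \<inter> X = {}" "(I \<union> X) \<inter> (J1 \<union> J2) = {}" "J1 \<inter> J2 = {}"
    and symm: "\<And>i j. M i j = M j i"
    and unit: "\<And>i j. i \<in> B \<Longrightarrow> j \<in> B \<Longrightarrow> M i j = (if i = j then 1 else 0)"
    and c: "\<And>j. c j > 0" and a: "a \<le> card J1" and b: "b \<le> card J2"
  defines "p \<equiv> (\<Sum>S | S \<subseteq> J1 \<and> card (J1 - S) = a. \<Sum>W | W \<subseteq> J2 \<and> card (J2 - W) = b.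
      smult ((\<Prod>j\<in>J1 - S. c j) * (\<Prod>j\<in>J2 - W. c j)) (index_det (B \<union> I \<union> X \<union> S \<union> W) (minor_pencil M X)))"
  shows "p = 0 \<or> real_rooted p"
proof -
  \<comment> \<open>The generating function adds to the diagonal, stability subtracts from it.\<close>
  define c' where "c' j = - complex_of_real (c j)" for j
  define K :: "complex \<Rightarrow> 'i \<Rightarrow> 'i \<Rightarrow> complex poly" where
    "K \<epsilon> i j = [:complex_of_real (M i j) - (if i = j \<and> i \<in> I then \<epsilon> else 0):]
      - (if i = j \<and> i \<in> X then [:0, 1:] else 0)" for \<epsilon> i j
  define g where "g \<epsilon> S W = index_det (B \<union> I \<union> X \<union> S \<union> W) (K \<epsilon>)" for \<epsilon> S W
  define Q where "Q \<epsilon> = (\<Sum>S\<in>Pow J1. \<Sum>W\<in>Pow J2.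
      smult (deriv_weight a c' J1 \<epsilon> S * deriv_weight b c' J2 \<epsilon> W) (g \<epsilon> S W))" for \<epsilon>
  have poly_K: "poly (K \<epsilon> i j) x = complex_of_real (M i j) - (if i = j \<and> i \<in> I then \<epsilon> else 0)
      - (if i = j \<and> i \<in> X then x else 0)" for \<epsilon> i j x
    by (auto simp: K_def)
  have poly_g: "poly (g \<epsilon> S W) x = index_det (B \<union> I \<union> X \<union> S \<union> W) (\<lambda>i j. poly (K \<epsilon> i j) x)" for \<epsilon> S W x
    by (simp add: g_def poly_index_det)
  have poly_Q: "poly (Q \<epsilon>) x = (\<Sum>S\<in>Pow J1. deriv_weight a c' J1 \<epsilon> S *
      (\<Sum>W\<in>Pow J2. deriv_weight b c' J2 \<epsilon> W * poly (g \<epsilon> S W) x))" for \<epsilon> x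
    by (simp add: Q_def poly_sum sum_distrib_left mult.assoc)
  have stable: "upper_stable (Q \<epsilon>)" if \<epsilon>: "Im \<epsilon> > 0" for \<epsilon>
    unfolding upper_stable_def poly_Q
  proof (intro allI impI)
    fix x assume x: "Im x > 0"
    show "(\<Sum>S\<in>Pow J1. deriv_weight a c' J1 \<epsilon> S *
      (\<Sum>W\<in>Pow J2. deriv_weight b c' J2 \<epsilon> W * poly (g \<epsilon> S W) x)) \<noteq> 0"
    proof (rule deriv_weight_double_sum_nonzero[OF fin(4,5) _ a b _ \<epsilon> \<epsilon>])
      show "c' j \<noteq> 0" for j using c[of j] by (simp add: c'_def)
      fix K1 K2 s t
      assume K12: "K1 = J1 \<or> K1 = {}" "K2 = J2 \<or> K2 = {}" and s: "Im s > 0" and t: "Im t > 0"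
      let ?N = "\<lambda>i j. poly (K \<epsilon> i j) x"
      \<comment> \<open>All shifts in one function; its values lie in the upper half-plane.\<close>
      define z where "z i = (if i \<in> I then \<epsilon> else if i \<in> X then x else
          if i \<in> K1 then c i * s else c i * t)" for i
      have finK: "finite K1" "finite K2" using K12 fin by auto
      have disjK: "K1 \<subseteq> J1" "K2 \<subseteq> J2" "K1 \<inter> K2 = {}" using K12 disj(4) by auto
      have inner: "(\<Sum>W\<in>Pow K2. (\<Prod>j\<in>K2 - W. c' j * t) * poly (g \<epsilon> S W) x) =
          index_det (B \<union> I \<union> X \<union> S \<union> K2) (\<lambda>i j. ?N i j + (if i = j \<and> i \<in> K2 then c' i * t else 0))"
        if "S \<subseteq> K1" for S
        unfolding poly_g
        by (rule index_det_add_diag[symmetric])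
           (use that finK disjK disj fin finite_subset in \<open>blast+\<close>)
      have "(\<Sum>S\<in>Pow K1. (\<Prod>j\<in>K1 - S. c' j * s) * (\<Sum>W\<in>Pow K2. (\<Prod>j\<in>K2 - W. c' j * t) * poly (g \<epsilon> S W) x)) =
          (\<Sum>S\<in>Pow K1. (\<Prod>j\<in>K1 - S. c' j * s) * index_det (B \<union> I \<union> X \<union> K2 \<union> S)
            (\<lambda>i j. ?N i j + (if i = j \<and> i \<in> K2 then c' i * t else 0)))"
      proof (rule sum.cong[OF refl])
        fix S assume "S \<in> Pow K1"
        then have S: "S \<subseteq> K1" by simp
        have "B \<union> I \<union> X \<union> S \<union> K2 = B \<union> I \<union> X \<union> K2 \<union> S" by auto
        then show "(\<Prod>j\<in>K1 - S. c' j * s) * (\<Sum>W\<in>Pow K2. (\<Prod>j\<in>K2 - W. c' j * t) * poly (g \<epsilon> S W) x) =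
          (\<Prod>j\<in>K1 - S. c' j * s) * index_det (B \<union> I \<union> X \<union> K2 \<union> S)
            (\<lambda>i j. ?N i j + (if i = j \<and> i \<in> K2 then c' i * t else 0))"
          unfolding inner[OF S] by simp
      qed
      also have "\<dots> = index_det (B \<union> I \<union> X \<union> K2 \<union> K1)
          (\<lambda>i j. ?N i j + (if i = j \<and> i \<in> K2 then c' i * t else 0) + (if i = j \<and> i \<in> K1 then c' i
              * s else 0))"
        by (rule index_det_add_diag[symmetric]) (use finK disjK disj fin in auto)
      also have "\<dots> = index_det (B \<union> (I \<union> X \<union> K1 \<union> K2))
          (\<lambda>i j. complex_of_real (M i j) + (if i = j \<and> i \<in> I \<union> X \<union> K1 \<union> K2 then - z i else 0))"
      proof -
        have "B \<union> I \<union> X \<union> K2 \<union> K1 = B \<union> (I \<union> X \<union> K1 \<union> K2)" by auto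
        moreover have "?N i j + (if i = j \<and> i \<in> K2 then c' i * t else 0) + (if i = j \<and> i \<in> K1 then
            c' i * s else 0) =
            complex_of_real (M i j) + (if i = j \<and> i \<in> I \<union> X \<union> K1 \<union> K2 then - z i else 0)" for i j
        proof (cases "i = j")
          case True
          consider "j \<notin> I \<union> X \<union> K1 \<union> K2" | "j \<in> I" "j \<notin> X" "j \<notin> K1" "j \<notin> K2"
            | "j \<in> X" "j \<notin> I" "j \<notin> K1" "j \<notin> K2" | "j \<in> K1" "j \<notin> I" "j \<notin> X" "j \<notin> K2"
            | "j \<in> K2" "j \<notin> I" "j \<notin> X" "j \<notin> K1"
            using disj disjK by blast
          then show ?thesis using True by cases (simp_all add: K_def z_def c'_def)
        qed (simp add: K_def)
        ultimately show ?thesis by simp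
      qed
      also have "\<dots> \<noteq> 0"
      proof (rule index_det_stable[OF _ _ _ symm unit])
        show "Im (z i) > 0" if "i \<in> I \<union> X \<union> K1 \<union> K2" for i
          using that \<epsilon> x s t c by (auto simp: z_def)
      qed (use fin finK disj disjK in auto)
      finally show "(\<Sum>S\<in>Pow K1. (\<Prod>j\<in>K1 - S. c' j * s) *
          (\<Sum>W\<in>Pow K2. (\<Prod>j\<in>K2 - W. c' j * t) * poly (g \<epsilon> S W) x)) \<noteq> 0" .
    qed
  qed
  have deg: "degree (Q \<epsilon>) \<le> card (B \<union> I \<union> X \<union> J1 \<union> J2)" for \<epsilon>
    unfolding Q_def
  proof (intro degree_sum_le finite_Pow_iff[THEN iffD2] fin)
    fix S W assume SW: "S \<in> Pow J1" "W \<in> Pow J2"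
    have fT: "finite (B \<union> I \<union> X \<union> S \<union> W)" using SW fin by (auto intro: finite_subset)
    have "degree (K \<epsilon> i j) \<le> 1" for i j
      unfolding K_def by (rule degree_diff_le) auto
    then have "degree (g \<epsilon> S W) \<le> card (B \<union> I \<union> X \<union> S \<union> W)"
      unfolding g_def by (rule degree_index_det_le[OF fT])
    also have "\<dots> \<le> card (B \<union> I \<union> X \<union> J1 \<union> J2)"
      using SW fin by (intro card_mono) auto
    finally show "degree (smult (deriv_weight a c' J1 \<epsilon> S * deriv_weight b c' J2 \<epsilon> W) (g \<epsilon> S W))
        \<le> card (B \<union> I \<union> X \<union> J1 \<union> J2)"
      using degree_smult_le le_trans by blast
  qed
  \<comment> \<open>Points of the upper half-plane that tend to \<open>0\<close>.\<close>
  define e where "e n = \<i> / of_nat (Suc n)" for n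
  have e0: "e \<longlonglongrightarrow> 0"
    unfolding e_def by (intro LIMSEQ_Suc lim_const_over_n)
  have "Q 0 = 0 \<or> upper_stable (Q 0)"
  proof (rule upper_stable_limit)
    show "upper_stable (Q (e n))" for n by (rule stable) (simp add: e_def)
    show "degree (Q (e n)) \<le> card (B \<union> I \<union> X \<union> J1 \<union> J2)" for n by (rule deg)
    fix x
    have w: "(\<lambda>n. deriv_weight a c' J (e n) S) \<longlonglongrightarrow> deriv_weight a c' J 0 S" for a J S
      unfolding deriv_weight_def by (rule isCont_tendsto_compose[OF poly_isCont e0])
    have e_if: "(\<lambda>n. if Q then e n else 0) \<longlonglongrightarrow> (if Q then 0 else 0)" for Q
      using e0 by (cases Q) simp_all
    have "(\<lambda>n. poly (g (e n) S W) x) \<longlonglongrightarrow> poly (g 0 S W) x" for S W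
      unfolding poly_g
    proof (rule index_det_tendsto)
      fix i j
      have "(\<lambda>n. complex_of_real (M i j) - (if i = j \<and> i \<in> I then e n else 0)
            - (if i = j \<and> i \<in> X then x else 0)) \<longlonglongrightarrow>
          complex_of_real (M i j) - (if i = j \<and> i \<in> I then 0 else 0) - (if i = j \<and> i \<in> X then x else 0)"
      proof (intro tendsto_intros)
        show "(\<lambda>n. if i = j \<and> i \<in> I then e n else 0) \<longlonglongrightarrow> (if i = j \<and> i \<in> I then 0 else 0)"
          by (rule e_if)
      qed
      then show "(\<lambda>n. poly (K (e n) i j) x) \<longlonglongrightarrow> poly (K 0 i j) x"
        unfolding poly_K .
    qed
    then show "(\<lambda>n. poly (Q (e n)) x) \<longlonglongrightarrow> poly (Q 0) x"
      unfolding poly_Q by (intro tendsto_intros w)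
  qed
  moreover have "Q 0 = smult (fact a * fact b * (-1) ^ a * (-1) ^ b) (cpoly p)"
  proof -
    have w0: "deriv_weight a c' J 0 S =
        (if card (J - S) = a then fact a * (-1) ^ a * complex_of_real (\<Prod>j\<in>J - S. c j) else 0)" for a J S
    proof -
      have "(\<Prod>j\<in>J - S. c' j) = (\<Prod>j\<in>J - S. (-1) * complex_of_real (c j))"
        by (simp add: c'_def)
      also have "\<dots> = (-1) ^ card (J - S) * complex_of_real (\<Prod>j\<in>J - S. c j)"
        unfolding prod.distrib by simp
      finally show ?thesis by (simp add: deriv_weight_0)
    qed
    have cpoly_g: "cpoly (index_det (B \<union> I \<union> X \<union> S \<union> W) (minor_pencil M X)) = g 0 S W" for S W
    proof -
      have "cpoly (minor_pencil M X i j) = K 0 i j" for i j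
        by (auto simp: minor_pencil_def K_def of_real_poly_hom.hom_minus of_real_hom.map_poly_pCons_hom)
      moreover have "cpoly (of_int (sign r)) = of_int (sign r)" for r :: "'i \<Rightarrow> 'i"
        by (cases r rule: sign_cases) (simp_all add: of_real_poly_hom.hom_uminus)
      ultimately show ?thesis
        by (simp add: g_def index_det_def of_real_poly_hom.hom_sum of_real_poly_hom.hom_prod
            of_real_poly_hom.hom_mult)
    qed
    have "smult (fact a * fact b * (-1) ^ a * (-1) ^ b) (cpoly p) =
        (\<Sum>S | S \<subseteq> J1 \<and> card (J1 - S) = a. \<Sum>W | W \<subseteq> J2 \<and> card (J2 - W) = b.
          smult (deriv_weight a c' J1 0 S * deriv_weight b c' J2 0 W) (g 0 S W))"
      unfolding p_def
      unfolding of_real_poly_hom.hom_sum smult_sum2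
      by (intro sum.cong refl) (simp add: of_real_hom.map_poly_hom_smult cpoly_g w0 mult_ac)
    also have "\<dots> = (\<Sum>S | S \<subseteq> J1 \<and> card (J1 - S) = a. \<Sum>W\<in>Pow J2.
          smult (deriv_weight a c' J1 0 S * deriv_weight b c' J2 0 W) (g 0 S W))"
      by (rule sum.cong[OF refl], rule sum.mono_neutral_left) (auto simp: fin w0)
    also have "\<dots> = Q 0" unfolding Q_def
      by (rule sum.mono_neutral_left) (auto simp: fin w0)
    finally show ?thesis by simp
  qed
  moreover have "(fact a * fact b * (-1) ^ a * (-1) ^ b :: complex) \<noteq> 0" by simp
  ultimately show ?thesis
    using real_rooted_of_upper_stable[of p] by (auto simp: upper_stable_def)
qed

section \<open>Common interlacings from root counts\<close>

definition linear_factors :: "real list \<Rightarrow> real poly" where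
  "linear_factors xs = (\<Prod>x\<leftarrow>xs. [:- x, 1:])"

lemma linear_factors_monic: "lead_coeff (linear_factors xs) = 1"
  and degree_linear_factors: "degree (linear_factors xs) = length xs"
  and proots_linear_factors: "proots (linear_factors xs) = mset xs"
  and linear_factors_nonzero: "linear_factors xs \<noteq> 0"
proof -
  have "linear_factors xs \<noteq> 0 \<and> lead_coeff (linear_factors xs) = 1 \<and>
      degree (linear_factors xs) = length xs \<and> proots (linear_factors xs) = mset xs"
  proof (induction xs)
    case (Cons x xs)
    then have *: "linear_factors xs \<noteq> 0" by simp
    have eq: "linear_factors (x # xs) = [:- x, 1:] * linear_factors xs" by (simp add: linear_factors_def)
    have "lead_coeff (linear_factors xs) = 1" using Cons by blast
    then have "lead_coeff (linear_factors (x # xs)) = 1" unfolding eq lead_coeff_mult by simp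
    then show ?case using Cons * unfolding eq
      by (simp add: degree_mult_eq proots_mult del: mult_pCons_left)
  qed (simp add: linear_factors_def)
  then show "lead_coeff (linear_factors xs) = 1" "degree (linear_factors xs) = length xs"
    "proots (linear_factors xs) = mset xs" "linear_factors xs \<noteq> 0" by auto
qed

lemma poly_linear_factors:
  "poly (cpoly (linear_factors xs)) z = (\<Prod>x\<leftarrow>xs. z - complex_of_real x)"
proof (induction xs)
  case (Cons x xs)
  have "linear_factors (x # xs) = [:- x, 1:] * linear_factors xs" by (simp add: linear_factors_def)
  then have "cpoly (linear_factors (x # xs)) = cpoly [:- x, 1:] * cpoly (linear_factors xs)"
    by (simp only: of_real_poly_hom.hom_mult)
  then have "poly (cpoly (linear_factors (x # xs))) z =
      poly (cpoly [:- x, 1:]) z * poly (cpoly (linear_factors xs)) z"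
    by (simp only: poly_mult)
  then show ?case using Cons by (simp add: map_poly_pCons)
qed (simp add: linear_factors_def)

lemma real_rooted_pos_linear_factors:
  assumes "c > 0"
  shows "real_rooted_pos (smult c (linear_factors xs))"
proof -
  have "z \<in> \<real>" if "poly (cpoly (smult c (linear_factors xs))) z = 0" for z
  proof -
    have "poly (cpoly (linear_factors xs)) z = 0"
      using that assms by (simp add: of_real_hom.map_poly_hom_smult)
    then show ?thesis by (auto simp: poly_linear_factors prod_list_zero_iff)
  qed
  then show ?thesis using assms
    by (simp add: real_rooted_pos_def real_rooted_def linear_factors_nonzero linear_factors_monic)
qed

lemma ith_largest_root_linear_factors:
  assumes "c \<noteq> 0" "sorted_wrt (\<ge>) xs"
  shows "ith_largest_root (Suc i) (smult c (linear_factors xs)) = xs ! i"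
proof -
  have "sorted (rev xs)" using assms(2) by (simp add: sorted_wrt_rev)
  then have "sort xs = rev xs" by (intro properties_for_sort) auto
  then show ?thesis using assms(1) by (simp add: ith_largest_root_def proots_linear_factors)
qed

lemma real_rooted_factorization:
  assumes "real_rooted p"
  obtains xs where "p = smult (lead_coeff p) (linear_factors xs)" "sorted_wrt (\<ge>) xs"
    "length xs = degree p"
proof -
  obtain zs where zs: "mset zs = proots (cpoly p)" using ex_mset by blast
  define xs where "xs = rev (sort (map Re zs))"
  have lc: "lead_coeff (cpoly p) = complex_of_real (lead_coeff p)" by simp
  have real: "complex_of_real (Re z) = z" if "z \<in> set zs" for z
  proof -
    have "p \<noteq> 0" using assms by (simp add: real_rooted_def)
    then have "poly (cpoly p) z = 0" using that set_mset_mset[of zs] unfolding zs by auto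
    then show ?thesis using assms by (simp add: real_rooted_def)
  qed
  have "poly p x = poly (smult (lead_coeff p) (linear_factors xs)) x" for x
  proof -
    have "complex_of_real (poly p x) = poly (cpoly p) (complex_of_real x)"
      by simp
    also have "cpoly p = smult (complex_of_real (lead_coeff p)) (\<Prod>z\<in>#mset zs. [:- z, 1:])"
      unfolding zs using complex_poly_decompose_multiset[of "cpoly p"] lc by metis
    also have "poly \<dots> (complex_of_real x) =
        complex_of_real (lead_coeff p) * (\<Prod>z\<in>#mset zs. complex_of_real x - z)"
      by (simp add: poly_prod_mset image_mset.compositionality o_def del: mset_map)
    also have "(\<Prod>z\<in>#mset zs. complex_of_real x - z) =
        (\<Prod>z\<in>#mset zs. complex_of_real x - complex_of_real (Re z))"
      by (intro arg_cong[of _ _ prod_mset] image_mset_cong) (simp add: real)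
    also have "\<dots> = (\<Prod>r\<in>#mset xs. complex_of_real x - complex_of_real r)"
      by (simp add: xs_def image_mset.compositionality o_def)
    also have "\<dots> = (\<Prod>r\<leftarrow>xs. complex_of_real x - complex_of_real r)"
      by (metis mset_map prod_mset_prod_list)
    also have "\<dots> = complex_of_real (poly (linear_factors xs) x)"
      using poly_linear_factors[of xs "complex_of_real x"] by simp
    finally show ?thesis by (simp flip: of_real_mult)
  qed
  then have p: "p = smult (lead_coeff p) (linear_factors xs)"
    using poly_eq_poly_eq_iff by blast
  show ?thesis
  proof
    show "p = smult (lead_coeff p) (linear_factors xs)" by (rule p)
    show "sorted_wrt (\<ge>) xs" by (simp add: xs_def sorted_wrt_rev)
    show "length xs = degree p"
      using assms arg_cong[OF p, of degree] by (simp add: degree_linear_factors real_rooted_def)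
  qed
qed

text \<open>
The argument of \<open>Complex t (1 / k) - r\<close>, for \<open>k > 0\<close>. The imaginary part is written as \<open>1 / k\<close> so that
the approach to the real axis is \<open>k \<rightarrow> \<infinity>\<close>.
\<close>

definition angle :: "real \<Rightarrow> real \<Rightarrow> real \<Rightarrow> real" where
  "angle k t r = pi / 2 - arctan (k * (t - r))"

lemma prod_polar:
  assumes "k > 0"
  obtains \<rho> where "\<rho> > 0"
    "(\<Prod>x\<leftarrow>xs. Complex t (1 / k) - complex_of_real x) = complex_of_real \<rho> * cis (\<Sum>x\<leftarrow>xs. angle k t x)"
proof -
  have "\<exists>\<rho>>0. (\<Prod>x\<leftarrow>xs. Complex t (1 / k) - complex_of_real x) =
      complex_of_real \<rho> * cis (\<Sum>x\<leftarrow>xs. angle k t x)"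
  proof (induction xs)
    case (Cons x xs)
    then obtain \<rho> where \<rho>: "\<rho> > 0" "(\<Prod>x\<leftarrow>xs. Complex t (1 / k) - complex_of_real x) =
      complex_of_real \<rho> * cis (\<Sum>x\<leftarrow>xs. angle k t x)" by blast
    define u where "u = k * (t - x)"
    have pos: "sqrt (1 + u\<^sup>2) > 0" by (simp add: add_pos_nonneg)
    have "Complex t (1 / k) - complex_of_real x = complex_of_real (sqrt (1 + u\<^sup>2) / k) * cis
        (angle k t x)"
      using assms pos
      by (simp add: complex_eq_iff angle_def u_def[symmetric] cos_diff sin_diff sin_arctan cos_arctan)
         (simp add: u_def)
    then show ?case using assms pos \<rho>
      by (intro exI[of _ "sqrt (1 + u\<^sup>2) / k * \<rho>"]) (simp add: cis_mult[symmetric] mult_ac)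
  qed (auto intro: exI[of _ 1])
  then show ?thesis using that by blast
qed

text \<open>
If the ratio of the two products avoids the negative reals in the upper half-plane, then its
argument, followed continuously from \<open>t = \<infinity>\<close> along a horizontal line, starts at \<open>0\<close> and can never
reach \<open>\<pi>\<close>.
\<close>

lemma angle_difference_less_pi:
  assumes "k > 0"
    and neq: "\<And>z \<rho>. Im z > 0 \<Longrightarrow> \<rho> > 0 \<Longrightarrow>
      (\<Prod>x\<leftarrow>xs. z - complex_of_real x) \<noteq> - complex_of_real \<rho> * (\<Prod>y\<leftarrow>ys. z - complex_of_real y)"
  shows "(\<Sum>x\<leftarrow>xs. angle k t x) - (\<Sum>y\<leftarrow>ys. angle k t y) < pi"
proof (rule ccontr)
  define \<Theta> where "\<Theta> s = (\<Sum>x\<leftarrow>xs. angle k s x) - (\<Sum>y\<leftarrow>ys. angle k s y)" for s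
  assume "\<not> ?thesis"
  then have ge: "\<Theta> t \<ge> pi" by (simp add: \<Theta>_def)
  have angle0: "((\<lambda>s. angle k s r) \<longlongrightarrow> 0) at_top" for r
  proof -
    have "filterlim (\<lambda>s. k * (s - r)) at_top at_top"
      using assms(1) filterlim_tendsto_add_at_top[OF tendsto_const[of "- r"] filterlim_ident]
      by (intro filterlim_tendsto_pos_mult_at_top[OF tendsto_const]) auto
    then have "((\<lambda>s. arctan (k * (s - r))) \<longlongrightarrow> pi / 2) at_top"
      by (rule filterlim_compose[OF tendsto_arctan_at_top])
    then have "((\<lambda>s. pi / 2 - arctan (k * (s - r))) \<longlongrightarrow> pi / 2 - pi / 2) at_top"
      by (intro tendsto_intros)
    then show ?thesis by (simp add: angle_def)
  qed
  have sum0: "((\<lambda>s. \<Sum>x\<leftarrow>xs. angle k s x) \<longlongrightarrow> 0) at_top" for xs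
    by (induction xs) (auto intro: tendsto_add_zero angle0)
  have cont: "isCont (\<lambda>s. \<Sum>x\<leftarrow>xs. angle k s x) s" for s xs
    by (induction xs) (auto simp: angle_def intro!: continuous_intros)
  have "(\<Theta> \<longlongrightarrow> 0) at_top"
    unfolding \<Theta>_def using tendsto_diff[OF sum0[of xs] sum0[of ys]] by simp
  then have "eventually (\<lambda>s. \<Theta> s < pi) at_top" by (rule order_tendstoD) simp
  then obtain T where T: "T \<ge> t" "\<Theta> T < pi"
    unfolding eventually_at_top_linorder by (metis max.cobounded1 max.cobounded2)
  have "\<forall>s. t \<le> s \<and> s \<le> T \<longrightarrow> isCont \<Theta> s" unfolding \<Theta>_def using cont by (auto intro!: continuous_intros)
  then obtain s where s: "\<Theta> s = pi" using IVT2[of \<Theta> T pi t] T ge by auto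
  let ?z = "Complex s (1 / k)"
  obtain \<rho>1 where \<rho>1: "\<rho>1 > 0"
    "(\<Prod>x\<leftarrow>xs. ?z - complex_of_real x) = complex_of_real \<rho>1 * cis (\<Sum>x\<leftarrow>xs. angle k s x)"
    using prod_polar[OF assms(1)] .
  obtain \<rho>2 where \<rho>2: "\<rho>2 > 0"
    "(\<Prod>y\<leftarrow>ys. ?z - complex_of_real y) = complex_of_real \<rho>2 * cis (\<Sum>y\<leftarrow>ys. angle k s y)"
    using prod_polar[OF assms(1)] .
  have "(\<Sum>x\<leftarrow>xs. angle k s x) = pi + (\<Sum>y\<leftarrow>ys. angle k s y)" using s by (simp add: \<Theta>_def)
  then have "cis (\<Sum>x\<leftarrow>xs. angle k s x) = - cis (\<Sum>y\<leftarrow>ys. angle k s y)"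
    by (simp add: cis_mult[symmetric])
  then have "(\<Prod>x\<leftarrow>xs. ?z - complex_of_real x) =
      - complex_of_real (\<rho>1 / \<rho>2) * (\<Prod>y\<leftarrow>ys. ?z - complex_of_real y)"
    using \<rho>1 \<rho>2 by simp
  then show False using neq[of ?z "\<rho>1 / \<rho>2"] \<rho>1(1) \<rho>2(1) assms(1) by simp
qed

text \<open>
As the horizontal line descends to the real axis, the argument of \<open>t - x\<close> tends to \<open>\<pi>\<close> for \<open>x > t\<close> and
to \<open>0\<close> for \<open>x < t\<close>. So the bound on the angles becomes a bound on the numbers of roots above \<open>t\<close>.
\<close>

lemma number_of_larger_roots_le:
  assumes neq: "\<And>z \<rho>. Im z > 0 \<Longrightarrow> \<rho> > 0 \<Longrightarrow>
      (\<Prod>x\<leftarrow>xs. z - complex_of_real x) \<noteq> - complex_of_real \<rho> * (\<Prod>y\<leftarrow>ys. z - complex_of_real y)"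
    and t: "t \<notin> set xs" "t \<notin> set ys"
  shows "length (filter (\<lambda>x. x > t) xs) \<le> length (filter (\<lambda>y. y > t) ys) + 1"
proof -
  have lim1: "(\<lambda>n. angle (real (Suc n)) t r) \<longlonglongrightarrow> (if r > t then pi else 0)" if "r \<noteq> t" for r
  proof (cases "r > t")
    case True
    have "filterlim (\<lambda>n. (t - r) * real (Suc n)) at_bot sequentially"
      using True by (intro filterlim_tendsto_neg_mult_at_bot[OF tendsto_const]
        filterlim_compose[OF filterlim_real_sequentially filterlim_Suc]) auto
    then have "(\<lambda>n. arctan ((t - r) * real (Suc n))) \<longlonglongrightarrow> - (pi / 2)"
      by (rule filterlim_compose[OF tendsto_arctan_at_bot])
    from tendsto_diff[OF tendsto_const[of "pi / 2"] this] show ?thesis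
      using True by (simp add: angle_def mult.commute)
  next
    case False
    have "filterlim (\<lambda>n. (t - r) * real (Suc n)) at_top sequentially"
      using False that by (intro filterlim_tendsto_pos_mult_at_top[OF tendsto_const]
        filterlim_compose[OF filterlim_real_sequentially filterlim_Suc]) auto
    then have "(\<lambda>n. arctan ((t - r) * real (Suc n))) \<longlonglongrightarrow> pi / 2"
      by (rule filterlim_compose[OF tendsto_arctan_at_top])
    from tendsto_diff[OF tendsto_const[of "pi / 2"] this] show ?thesis
      using False by (simp add: angle_def mult.commute)
  qed
  have lim: "(\<lambda>n. \<Sum>x\<leftarrow>xs. angle (real (Suc n)) t x) \<longlonglongrightarrow> pi * real (length (filter (\<lambda>x. x > t) xs))"
    if "t \<notin> set xs" for xs
    using that
  proof (induction xs)
    case (Cons x xs)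
    then have "(\<lambda>n. angle (real (Suc n)) t x + (\<Sum>x\<leftarrow>xs. angle (real (Suc n)) t x)) \<longlonglongrightarrow>
        (if x > t then pi else 0) + pi * real (length (filter (\<lambda>x. x > t) xs))"
      by (intro tendsto_add lim1) auto
    then show ?case by (simp add: algebra_simps split: if_splits)
  qed simp
  have "pi * real (length (filter (\<lambda>x. x > t) xs)) - pi * real (length (filter (\<lambda>y. y > t) ys)) \<le> pi"
  proof (rule LIMSEQ_le_const2)
    show "(\<lambda>n. (\<Sum>x\<leftarrow>xs. angle (real (Suc n)) t x) - (\<Sum>y\<leftarrow>ys. angle (real (Suc n)) t y)) \<longlonglongrightarrow>
        pi * real (length (filter (\<lambda>x. x > t) xs)) - pi * real (length (filter (\<lambda>y. y > t) ys))"
      by (intro tendsto_diff lim t)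
    show "\<exists>N. \<forall>n\<ge>N. (\<Sum>x\<leftarrow>xs. angle (real (Suc n)) t x) - (\<Sum>y\<leftarrow>ys. angle (real (Suc n)) t y) \<le> pi"
      using angle_difference_less_pi[OF _ neq] by (intro exI allI impI less_imp_le) auto
  qed
  then have "pi * real (length (filter (\<lambda>x. x > t) xs)) \<le> pi * (real (length (filter
      (\<lambda>y. y > t) ys)) + 1)"
    by (simp add: algebra_simps)
  then show ?thesis by (simp del: of_nat_Suc)
qed

text \<open>
Otherwise some \<open>t\<close> strictly between the two roots has at least \<open>i + 2\<close> elements of \<open>xs\<close> above it but at
most \<open>i\<close> of \<open>ys\<close>.
\<close>

lemma next_root_le:
  fixes xs ys :: "real list"
  assumes le: "\<And>t. t \<notin> set xs \<Longrightarrow> t \<notin> set ys \<Longrightarrow>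
      length (filter (\<lambda>x. x > t) xs) \<le> length (filter (\<lambda>y. y > t) ys) + 1"
    and sorted: "sorted_wrt (\<ge>) xs" "sorted_wrt (\<ge>) ys"
    and i: "Suc i < length xs" "i < length ys"
  shows "xs ! Suc i \<le> ys ! i"
proof (rule ccontr)
  assume "\<not> ?thesis"
  then have "infinite {ys ! i <..< xs ! Suc i}" by (simp add: infinite_Ioo)
  then have "infinite ({ys ! i <..< xs ! Suc i} - (set xs \<union> set ys))" by (simp add: Diff_infinite_finite)
  then have "{ys ! i <..< xs ! Suc i} - (set xs \<union> set ys) \<noteq> {}" by (rule infinite_imp_nonempty)
  then obtain t where "t \<in> {ys ! i <..< xs ! Suc i} - (set xs \<union> set ys)" by blast
  then have t: "ys ! i < t" "t < xs ! Suc i" "t \<notin> set xs" "t \<notin> set ys" by auto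
  have "{..Suc i} \<subseteq> {j. j < length xs \<and> t < xs ! j}"
  proof
    fix j assume "j \<in> {..Suc i}"
    then have "xs ! j \<ge> xs ! Suc i"
      using sorted(1) i(1) by (cases "j = Suc i") (auto simp: sorted_wrt_iff_nth_less)
    then show "j \<in> {j. j < length xs \<and> t < xs ! j}" using t i \<open>j \<in> _\<close> by auto
  qed
  then have "i + 2 \<le> length (filter (\<lambda>x. x > t) xs)"
    unfolding length_filter_conv_card by (drule_tac card_mono[rotated]) auto
  moreover have "{j. j < length ys \<and> t < ys ! j} \<subseteq> {..<i}"
  proof
    fix j assume j: "j \<in> {j. j < length ys \<and> t < ys ! j}"
    have "\<not> i \<le> j"
    proof
      assume "i \<le> j"
      then have "ys ! j \<le> ys ! i"
        using sorted(2) j by (cases "j = i") (auto simp: sorted_wrt_iff_nth_less)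
      then show False using t j by auto
    qed
    then show "j \<in> {..<i}" by simp
  qed
  then have "length (filter (\<lambda>y. y > t) ys) \<le> i"
    unfolding length_filter_conv_card by (drule_tac card_mono[rotated]) auto
  ultimately show False using le[OF t(3,4)] by simp
qed

lemma length_le_of_larger_roots:
  fixes xs ys :: "real list"
  assumes le: "\<And>t. t \<notin> set xs \<Longrightarrow> t \<notin> set ys \<Longrightarrow>
      length (filter (\<lambda>x. x > t) xs) \<le> length (filter (\<lambda>y. y > t) ys) + 1"
  shows "length xs \<le> length ys + 1"
proof -
  \<comment> \<open>The element \<open>0\<close> only makes the set nonempty.\<close>
  define t where "t = Min (insert 0 (set xs \<union> set ys)) - 1"
  have t: "\<forall>x\<in>set xs \<union> set ys. t < x"
  proof
    fix x assume "x \<in> set xs \<union> set ys"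
    then have "Min (insert 0 (set xs \<union> set ys)) \<le> x" by (intro Min_le) auto
    then show "t < x" by (simp add: t_def)
  qed
  then have "filter (\<lambda>x. x > t) xs = xs" "filter (\<lambda>y. y > t) ys = ys" by (auto simp: filter_id_conv)
  then show ?thesis using le[of t] t by force
qed

text \<open>
Obreschkoff's theorem in the direction that is needed. The numbers of roots of \<open>f\<close> and \<open>g\<close> above any
point differ by at most one, so the \<open>(i + 1)\<close>-st root of each is at most the \<open>i\<close>-th root of the other;
the larger of the two \<open>i\<close>-th roots then defines an interlacing polynomial.
\<close>

lemma common_interlacing_pair:
  fixes f g :: "real poly"
  assumes fg: "real_rooted_pos f" "real_rooted_pos g"
    and neq: "\<And>z \<mu>. Im z > 0 \<Longrightarrow> \<mu> > 0 \<Longrightarrow> poly (cpoly f) z + complex_of_real \<mu> * poly (cpoly g) z \<noteq> 0"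
  shows "have_common_interlacing {f, g}" "degree f \<le> degree g + 1" "degree g \<le> degree f + 1"
proof -
  have main: "have_common_interlacing {f, g}" "degree f \<le> degree g + 1"
    if fg: "real_rooted_pos f" "real_rooted_pos g" and deg: "degree g \<le> degree f"
    and neq: "\<And>z \<mu>. Im z > 0 \<Longrightarrow> \<mu> > 0 \<Longrightarrow> poly (cpoly f) z + complex_of_real \<mu> * poly (cpoly g) z \<noteq> 0"
    for f g :: "real poly"
  proof -
    define a b where "a = lead_coeff f" and "b = lead_coeff g"
    have pos: "a > 0" "b > 0" using fg by (auto simp: real_rooted_pos_def a_def b_def)
    obtain xs where xs: "f = smult a (linear_factors xs)" "sorted_wrt (\<ge>) xs" "length xs = degree f"
      using real_rooted_factorization fg(1) unfolding real_rooted_pos_def a_def by metis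
    obtain ys where ys: "g = smult b (linear_factors ys)" "sorted_wrt (\<ge>) ys" "length ys = degree g"
      using real_rooted_factorization fg(2) unfolding real_rooted_pos_def b_def by metis
    have f: "poly (cpoly f) z = complex_of_real a * (\<Prod>x\<leftarrow>xs. z - complex_of_real x)" for z
      by (subst xs(1)) (simp add: of_real_hom.map_poly_hom_smult poly_linear_factors)
    have g: "poly (cpoly g) z = complex_of_real b * (\<Prod>y\<leftarrow>ys. z - complex_of_real y)" for z
      by (subst ys(1)) (simp add: of_real_hom.map_poly_hom_smult poly_linear_factors)
    have neq1: "(\<Prod>x\<leftarrow>xs. z - complex_of_real x) \<noteq> - complex_of_real \<rho> * (\<Prod>y\<leftarrow>ys. z - complex_of_real y)"
      if "Im z > 0" "\<rho> > 0" for z \<rho>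
      using neq[of z "\<rho> * a / b"] that pos unfolding f g by auto
    have neq2: "(\<Prod>y\<leftarrow>ys. z - complex_of_real y) \<noteq> - complex_of_real \<rho> * (\<Prod>x\<leftarrow>xs. z - complex_of_real x)"
      if "Im z > 0" "\<rho> > 0" for z \<rho>
      using neq1[of z "1 / \<rho>"] that by auto
    note N1 = number_of_larger_roots_le[OF neq1] and N2 = number_of_larger_roots_le[OF neq2]
    have len: "length xs \<le> length ys + 1" using length_le_of_larger_roots N1 by blast
    then show "degree f \<le> degree g + 1" using xs ys by simp
    have le1: "xs ! Suc i \<le> ys ! i" if "Suc i < length xs" "i < length ys" for i
      using next_root_le[OF N1 xs(2) ys(2) that] by blast
    have le2: "ys ! Suc i \<le> xs ! i" if "Suc i < length ys" "i < length xs" for i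
      using next_root_le[OF N2 ys(2) xs(2) that] by blast
    have down: "xs ! Suc i \<le> xs ! i" if "Suc i < length xs" for i
      using xs(2) that by (simp add: sorted_wrt_iff_nth_less)
    have down': "ys ! Suc i \<le> ys ! i" if "Suc i < length ys" for i
      using ys(2) that by (simp add: sorted_wrt_iff_nth_less)
    \<comment> \<open>\<open>g\<close> has at most as many roots as \<open>f\<close>; if it has one less, \<open>f\<close> alone supplies the last one.\<close>
    define zs where "zs = map (\<lambda>i. if i < length ys then max (xs ! i) (ys ! i) else xs ! i)
        [0..<length xs]"
    have len_zs: "length zs = length xs" by (simp add: zs_def)
    have zs: "zs ! i = (if i < length ys then max (xs ! i) (ys ! i) else xs ! i)" if "i < length xs"
        for i
      using that by (simp add: zs_def)
    have below: "zs ! Suc i \<le> xs ! i" "i < length ys \<Longrightarrow> zs ! Suc i \<le> ys ! i"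
      if "Suc i < length xs" for i
      using that le1[of i] le2[of i] down[of i] down'[of i] by (auto simp: zs)
    have above: "xs ! i \<le> zs ! i" "i < length ys \<Longrightarrow> ys ! i \<le> zs ! i" if "i < length xs" for i
      using that by (auto simp: zs)
    have "zs ! Suc i \<le> zs ! i" if "Suc i < length xs" for i
      using below(1)[of i] above(1)[of i] that by linarith
    then have sorted: "sorted_wrt (\<ge>) zs"
      using len_zs by (auto simp: sorted_wrt_iff_nth_Suc_transp transp_on_def)
    define h where "h = smult 1 (linear_factors zs)"
    have rth: "ith_largest_root (Suc i) h = zs ! i" for i
      unfolding h_def by (rule ith_largest_root_linear_factors) (use sorted in auto)
    have rtf: "ith_largest_root (Suc i) f = xs ! i" for i
      by (subst xs(1), rule ith_largest_root_linear_factors) (use xs pos in auto)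
    have rtg: "ith_largest_root (Suc i) g = ys ! i" for i
      by (subst ys(1), rule ith_largest_root_linear_factors) (use ys pos in auto)
    have h: "real_rooted_pos h" unfolding h_def by (rule real_rooted_pos_linear_factors) simp
    have deg_h: "degree h = length xs" by (simp add: h_def degree_linear_factors len_zs)
    have shift: "(\<forall>i\<in>{1..n}. P i) \<longleftrightarrow> (\<forall>i<n. P (Suc i))"
      "(\<forall>i\<in>{1..<n}. P i) \<longleftrightarrow> (\<forall>i. Suc i < n \<longrightarrow> P (Suc i))" for n and P :: "nat \<Rightarrow> bool"
      by (auto simp: Suc_le_eq gr0_conv_Suc)
    have "interlaces h f"
      using fg h above below unfolding interlaces_def shift Suc_eq_plus1[symmetric] rth rtf deg_h xs(3)
      by auto
    moreover have "interlaces h g"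
    proof (cases "length ys = length xs")
      case True
      then show ?thesis
        using fg h above below ys unfolding interlaces_def shift Suc_eq_plus1[symmetric] rth rtg deg_h
        by auto
    next
      case False
      then have "length xs = Suc (length ys)" using deg len xs ys by simp
      then show ?thesis
        using fg h above below ys unfolding interlaces_def shift Suc_eq_plus1[symmetric] rth rtg deg_h
        by auto
    qed
    ultimately show "have_common_interlacing {f, g}" by (auto simp: have_common_interlacing_def)
  qed
  have neq': "poly (cpoly g) z + complex_of_real \<mu> * poly (cpoly f) z \<noteq> 0" if "Im z > 0" "\<mu> > 0" for z \<mu>
  proof
    assume "poly (cpoly g) z + complex_of_real \<mu> * poly (cpoly f) z = 0"
    then have "complex_of_real (1 / \<mu>) * (poly (cpoly g) z + complex_of_real \<mu> * poly (cpoly f) z) = 0"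
      by simp
    then have "poly (cpoly f) z + complex_of_real (1 / \<mu>) * poly (cpoly g) z = 0"
      using that by (simp add: distrib_left add.commute)
    then show False using neq[of z "1 / \<mu>"] that by simp
  qed
  show "have_common_interlacing {f, g}" "degree f \<le> degree g + 1" "degree g \<le> degree f + 1"
  proof -
    show "have_common_interlacing {f, g}"
      using main(1)[OF fg _ neq] main(1)[OF fg(2,1) _ neq'] by (cases "degree g \<le> degree f") (auto
          simp: insert_commute)
    show "degree f \<le> degree g + 1"
      using main(2)[OF fg _ neq] by (cases "degree g \<le> degree f") auto
    show "degree g \<le> degree f + 1"
      using main(2)[OF fg(2,1) _ neq'] by (cases "degree f \<le> degree g") auto
  qed
qed

section \<open>Interlacing families from decision trees\<close>

text \<open>
Sums of such polynomials have no cancellation of leading terms, so degrees of averages are maxima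
of degrees.
\<close>

definition nonneg_lead :: "real poly \<Rightarrow> bool" where
  "nonneg_lead p \<longleftrightarrow> p = 0 \<or> lead_coeff p > 0"

lemma nonneg_leadI:
  assumes "\<And>x. x > 0 \<Longrightarrow> poly p x \<ge> 0"
  shows "nonneg_lead p"
proof (rule ccontr)
  assume "\<not> nonneg_lead p"
  then have "lead_coeff (- p) > 0" by (auto simp: nonneg_lead_def not_less le_less)
  then obtain n where n: "\<forall>x\<ge>n. lead_coeff (- p) \<le> poly (- p) x" using poly_pinfty_gt_lc by blast
  have "lead_coeff (- p) \<le> poly (- p) (max n 1)" using n by (meson max.cobounded1)
  moreover have "(0::real) < max n 1" by linarith
  ultimately show False using assms[of "max n 1"] \<open>lead_coeff (- p) > 0\<close> by simp
qed

lemma nonneg_lead_add: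
  assumes "nonneg_lead p" "nonneg_lead q"
  shows "nonneg_lead (p + q)" "ext_degree (p + q) = max (ext_degree p) (ext_degree q)"
proof -
  have "nonneg_lead (p + q) \<and> ext_degree (p + q) = max (ext_degree p) (ext_degree q)"
  proof (cases "p = 0 \<or> q = 0")
    case False
    then have lc: "lead_coeff p > 0" "lead_coeff q > 0" using assms by (auto simp: nonneg_lead_def)
    show ?thesis
    proof (cases "degree p" "degree q" rule: linorder_cases)
      case less
      then have "degree (p + q) = degree q" "lead_coeff (p + q) = lead_coeff q"
        by (auto simp: degree_add_eq_right coeff_eq_0)
      then show ?thesis using False lc less by (auto simp: nonneg_lead_def ext_degree_def)
    next
      case greater
      then have "degree (p + q) = degree p" "lead_coeff (p + q) = lead_coeff p"
        by (auto simp: degree_add_eq_left coeff_eq_0)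
      then show ?thesis using False lc greater by (auto simp: nonneg_lead_def ext_degree_def)
    next
      case equal
      then have c: "coeff (p + q) (degree p) > 0" using lc by simp
      have "p + q \<noteq> 0" using c by (metis coeff_0 less_irrefl)
      moreover have "degree (p + q) = degree p"
        using c le_degree[of "p + q" "degree p"] degree_add_le[of p "degree p" q] equal by simp
      ultimately show ?thesis using False c equal by (auto simp: nonneg_lead_def ext_degree_def)
    qed
  qed (use assms in \<open>auto simp: nonneg_lead_def ext_degree_def\<close>)
  then show "nonneg_lead (p + q)" "ext_degree (p + q) = max (ext_degree p) (ext_degree q)" by auto
qed

lemma nonneg_lead_smult:
  assumes "nonneg_lead p" "c > 0"
  shows "nonneg_lead (smult c p)" "ext_degree (smult c p) = ext_degree p"
  using assms by (auto simp: nonneg_lead_def ext_degree_def)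

lemma nonneg_lead_sum:
  assumes "finite F" "F \<noteq> {}" "\<And>T. T \<in> F \<Longrightarrow> nonneg_lead (q T)"
  shows "nonneg_lead (\<Sum>T\<in>F. q T) \<and> ext_degree (\<Sum>T\<in>F. q T) = Max (ext_degree ` q ` F)"
  using assms
proof (induction F rule: finite_ne_induct)
  case (insert T F)
  then show ?case by (simp add: nonneg_lead_add)
qed simp

definition average :: "('s \<Rightarrow> real poly) \<Rightarrow> 's set \<Rightarrow> real poly" where
  "average q F = smult (1 / real (card F)) (\<Sum>T\<in>F. q T)"

lemma average_nonneg_lead:
  assumes "finite F" "F \<noteq> {}" "\<And>T. T \<in> F \<Longrightarrow> nonneg_lead (q T)"
  shows "nonneg_lead (average q F)" "ext_degree (average q F) = Max (ext_degree ` q ` F)"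
proof -
  have "1 / real (card F) > 0" using assms by (simp add: card_gt_0_iff)
  then show "nonneg_lead (average q F)" "ext_degree (average q F) = Max (ext_degree ` q ` F)"
    using nonneg_lead_sum[OF assms] by (simp_all add: average_def nonneg_lead_smult)
qed

lemma card_smult_average:
  assumes "finite F" "F \<noteq> {}"
  shows "smult (real (card F)) (average q F) = (\<Sum>T\<in>F. q T)"
  using assms by (simp add: average_def)

text \<open>
The tree asks for one element after the other whether it belongs to the chosen set, and labels a
node by the average over the sets that remain. Questions with a forced answer are skipped, so that
no average is over an empty family.
\<close>

fun decision_tree :: "('i set \<Rightarrow> real poly) \<Rightarrow> 'i list \<Rightarrow> 'i set set \<Rightarrow> ltree" where
  "decision_tree q [] F = Node (average q F) []"
| "decision_tree q (e # es) F =
    (if {T\<in>F. e \<in> T} = {} \<or> {T\<in>F. e \<notin> T} = {} then decision_tree q es F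
     else Node (average q F) [decision_tree q es {T\<in>F. e \<in> T}, decision_tree q es {T\<in>F. e \<notin> T}])"

lemma label_decision_tree: "label (decision_tree q es F) = average q F"
  by (induction q es F rule: decision_tree.induct) auto

lemma leaf_labels_Node:
  "leaf_labels (Node f ts) = (if ts = [] then {f} else \<Union> (leaf_labels ` set ts))"
  by (auto simp: leaf_labels_def is_leaf_def)

text \<open>
Once all elements of a separating list are decided, a single set remains, and its average is its
own label.
\<close>

lemma leaf_labels_decision_tree:
  assumes "finite F" "F \<noteq> {}"
    and "\<And>T T'. T \<in> F \<Longrightarrow> T' \<in> F \<Longrightarrow> T \<inter> set es = T' \<inter> set es \<Longrightarrow> T = T'"
  shows "leaf_labels (decision_tree q es F) = q ` F"
  using assms
proof (induction es arbitrary: F)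
  case Nil
  then obtain T where "F = {T}" by auto
  then show ?case by (simp add: leaf_labels_Node average_def)
next
  case (Cons e es)
  have sep: "T = T'" if "T \<in> F" "T' \<in> F" "T \<inter> set es = T' \<inter> set es" "e \<in> T \<longleftrightarrow> e \<in> T'" for T T'
    using Cons.prems(3)[OF that(1,2)] that(3,4) by auto
  show ?case
  proof (cases "{T\<in>F. e \<in> T} = {} \<or> {T\<in>F. e \<notin> T} = {}")
    case True
    have "leaf_labels (decision_tree q es F) = q ` F"
    proof (rule Cons.IH[OF Cons.prems(1,2)])
      fix T T' assume "T \<in> F" "T' \<in> F" "T \<inter> set es = T' \<inter> set es"
      moreover from this(1,2) have "e \<in> T \<longleftrightarrow> e \<in> T'" using True by blast
      ultimately show "T = T'" by (rule sep)
    qed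
    then show ?thesis using True by auto
  next
    case False
    have part: "leaf_labels (decision_tree q es G) = q ` G"
      if "G = {T\<in>F. e \<in> T} \<or> G = {T\<in>F. e \<notin> T}" for G
    proof (rule Cons.IH)
      show "finite G" "G \<noteq> {}" using that Cons.prems(1) False by auto
      fix T T' assume *: "T \<in> G" "T' \<in> G" "T \<inter> set es = T' \<inter> set es"
      show "T = T'" by (rule sep[OF _ _ *(3)]) (use that * in auto)
    qed
    have "leaf_labels (decision_tree q es {T\<in>F. e \<in> T}) = q ` {T\<in>F. e \<in> T}"
      "leaf_labels (decision_tree q es {T\<in>F. e \<notin> T}) = q ` {T\<in>F. e \<notin> T}"
      using part by blast+
    then show ?thesis using False by (auto simp: leaf_labels_Node)
  qed
qed

definition subcube :: "'i set set \<Rightarrow> 'i set \<Rightarrow> 'i set \<Rightarrow> 'i set set" where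
  "subcube \<F> In Out = {T \<in> \<F>. In \<subseteq> T \<and> T \<inter> Out = {}}"

lemma split_subcube:
  "{T \<in> subcube \<F> In Out. e \<in> T} = subcube \<F> (insert e In) Out"
  "{T \<in> subcube \<F> In Out. e \<notin> T} = subcube \<F> In (insert e Out)"
  by (auto simp: subcube_def)

text \<open>
The conditions on a tree, with degrees compared to the label of the node itself instead of the
root; this form does not refer to the rest of the tree, so it can be proved node by node.
\<close>

definition good_node :: "ltree \<Rightarrow> bool" where
  "good_node v \<longleftrightarrow> (label v = 0 \<or> real_rooted_pos (label v)) \<and>
     (\<not> is_leaf v \<longrightarrow> convex_combination (label v) (map label (children v)) \<and>
       (\<forall>g \<in> child_labels v - {0}. ext_degree g = ext_degree (label v) \<or>
         ext_degree g = ext_degree (label v) - 1) \<and>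
       have_common_interlacing (child_labels v - {0}))"

lemma real_rooted_no_upper_root:
  assumes "real_rooted p" "Im z > 0"
  shows "poly (cpoly p) z \<noteq> 0"
  using assms by (auto simp: real_rooted_def complex_is_Real_iff)

text \<open>
Two siblings, either of which may be zero. Positivity of the leading coefficients excludes that a
positive combination of two nonzero children vanishes.
\<close>

lemma common_interlacing_children:
  assumes f: "f = 0 \<or> real_rooted_pos f" and g: "g = 0 \<or> real_rooted_pos g"
    and fg: "\<And>\<mu>. \<mu> > 0 \<Longrightarrow> f + smult \<mu> g = 0 \<or> real_rooted (f + smult \<mu> g)"
  shows "have_common_interlacing ({f, g} - {0})"
    and "\<And>h. h \<in> {f, g} - {0} \<Longrightarrow> ext_degree h = max (ext_degree f) (ext_degree g) \<or>
      ext_degree h = max (ext_degree f) (ext_degree g) - 1"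
proof -
  have single: "have_common_interlacing {h}" if "real_rooted_pos h" for h
  proof -
    have "poly (cpoly h) z + complex_of_real \<mu> * poly (cpoly h) z \<noteq> 0" if "Im z > 0" "\<mu> > 0" for z \<mu>
    proof -
      have "complex_of_real (1 + \<mu>) \<noteq> 0" using that(2) by (subst of_real_eq_0_iff) linarith
      moreover have "poly (cpoly h) z \<noteq> 0"
        using \<open>real_rooted_pos h\<close> that(1) by (simp add: real_rooted_pos_def real_rooted_no_upper_root)
      ultimately have "complex_of_real (1 + \<mu>) * poly (cpoly h) z \<noteq> 0" by simp
      then show ?thesis by (simp add: distrib_right)
    qed
    from common_interlacing_pair(1)[OF that that this] show ?thesis by simp
  qed
  have "have_common_interlacing ({f, g} - {0}) \<and> (\<forall>h \<in> {f, g} - {0}.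
      ext_degree h = max (ext_degree f) (ext_degree g) \<or>
      ext_degree h = max (ext_degree f) (ext_degree g) - 1)"
  proof (cases "f = 0 \<or> g = 0")
    case True
    then consider "f = 0" "g = 0" | "f = 0" "g \<noteq> 0" | "f \<noteq> 0" "g = 0" by blast
    then show ?thesis
      by cases (use f g single in \<open>auto simp: have_common_interlacing_def ext_degree_def\<close>)
  next
    case False
    then have pos: "real_rooted_pos f" "real_rooted_pos g" using f g by auto
    have neq: "poly (cpoly f) z + complex_of_real \<mu> * poly (cpoly g) z \<noteq> 0" if "Im z > 0" "\<mu> > 0" for z \<mu>
    proof -
      have "nonneg_lead f" "nonneg_lead (smult \<mu> g)"
        using pos \<open>\<mu> > 0\<close> by (auto simp: nonneg_lead_def real_rooted_pos_def)
      then have "ext_degree (f + smult \<mu> g) = max (ext_degree f) (ext_degree (smult \<mu> g))"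
        by (rule nonneg_lead_add)
      then have "f + smult \<mu> g \<noteq> 0" using False by (auto simp: ext_degree_def max_def split: if_splits)
      then have "poly (cpoly (f + smult \<mu> g)) z \<noteq> 0"
        using fg[OF that(2)] that(1) real_rooted_no_upper_root by blast
      then show ?thesis
        by (simp add: of_real_hom.map_poly_hom_add of_real_hom.map_poly_hom_smult)
    qed
    note pair = common_interlacing_pair[OF pos neq]
    have "{f, g} - {0} = {f, g}" using False by auto
    moreover have near: "ereal (real n) = max (ereal (real n)) (ereal (real m)) \<or>
        ereal (real n) = max (ereal (real n)) (ereal (real m)) - 1" if "m \<le> n + 1" for m n :: nat
      using that by (cases "m \<le> n") (auto simp: max_def one_ereal_def)
    ultimately show ?thesis
      using pair False near[of "degree g" "degree f"] near[of "degree f" "degree g"]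
      by (simp add: ext_degree_def max.commute)
  qed
  then show "have_common_interlacing ({f, g} - {0})"
    and "\<And>h. h \<in> {f, g} - {0} \<Longrightarrow> ext_degree h = max (ext_degree f) (ext_degree g) \<or>
      ext_degree h = max (ext_degree f) (ext_degree g) - 1" by auto
qed

text \<open>
At a node that splits on \<open>e\<close>, the weight \<open>c e\<close> multiplies exactly the sets that do not contain
\<open>e\<close>. Hence \<open>stable\<close> with all other weights equal to \<open>1\<close> covers every positive combination of
the two children, as \<open>common_interlacing_children\<close> demands.
\<close>

lemma good_nodes_decision_tree:
  assumes E: "finite E" "set es \<subseteq> E" and fin: "finite \<F>" and ne: "subcube \<F> In Out \<noteq> {}"
    and nonneg: "\<And>T. T \<in> \<F> \<Longrightarrow> nonneg_lead (q T)"
    and stable: "\<And>In Out c. (\<And>j. c j > 0) \<Longrightarrow>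
      (\<Sum>T\<in>subcube \<F> In Out. smult (\<Prod>j\<in>E - T. c j) (q T)) = 0 \<or>
      real_rooted (\<Sum>T\<in>subcube \<F> In Out. smult (\<Prod>j\<in>E - T. c j) (q T))"
    and v: "v \<in> nodes (decision_tree q es (subcube \<F> In Out))"
  shows "good_node v"
proof -
  have finI: "finite (subcube \<F> In Out)" for In Out using fin by (auto simp: subcube_def)
  have nonnegI: "nonneg_lead (q T)" if "T \<in> subcube \<F> In Out" for T In Out
    using that nonneg by (auto simp: subcube_def)
  have real_rooted_average: "average q (subcube \<F> In Out) = 0 \<or> real_rooted_pos (average q
      (subcube \<F> In Out))"
    if "subcube \<F> In Out \<noteq> {}" for In Out
  proof -
    let ?F = "subcube \<F> In Out"
    have "card ?F > 0" using that finI by (simp add: card_gt_0_iff)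
    have "(\<Sum>T\<in>?F. q T) = 0 \<or> real_rooted (\<Sum>T\<in>?F. q T)"
      using stable[of "\<lambda>_. 1" In Out] by simp
    then have "average q ?F = 0 \<or> real_rooted (average q ?F)"
      using \<open>card ?F > 0\<close> by (auto simp: average_def real_rooted_def of_real_hom.map_poly_hom_smult)
    moreover have "nonneg_lead (average q ?F)" using average_nonneg_lead(1)[OF finI that nonnegI] .
    ultimately show ?thesis by (auto simp: real_rooted_pos_def nonneg_lead_def)
  qed
  show ?thesis using E(2) ne v
  proof (induction es arbitrary: In Out)
    case Nil
    then show ?case using real_rooted_average by (auto simp: good_node_def is_leaf_def)
  next
    case (Cons e es)
    let ?F = "subcube \<F> In Out" and ?G1 = "subcube \<F> (insert e In) Out" and ?G0 = "subcube \<F> In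
        (insert e Out)"
    show ?case
    proof (cases "?G1 = {} \<or> ?G0 = {}")
      case True
      then show ?thesis using Cons.IH[of In Out] Cons.prems by (auto simp: split_subcube)
    next
      case False
      then have ne: "?G1 \<noteq> {}" "?G0 \<noteq> {}" by auto
      have tree: "decision_tree q (e # es) ?F =
          Node (average q ?F) [decision_tree q es ?G1, decision_tree q es ?G0]"
        by (simp only: decision_tree.simps split_subcube ne simp_thms if_False)
      consider "v = decision_tree q (e # es) ?F" | "v \<in> nodes (decision_tree q es ?G1)"
        | "v \<in> nodes (decision_tree q es ?G0)"
        using Cons.prems(3) unfolding tree by auto
      then show ?thesis
      proof cases
        case 1
        define c c0 c1 where "c = real (card ?F)" and "c0 = real (card ?G0)" and "c1 = real (card ?G1)"
        define f f0 f1 where "f = average q ?F" and "f0 = average q ?G0" and "f1 = average q ?G1"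
        have split: "?F = ?G1 \<union> ?G0" "?G1 \<inter> ?G0 = {}" by (auto simp: subcube_def)
        have pos: "c0 > 0" "c1 > 0" using ne finI by (auto simp: c0_def c1_def card_gt_0_iff)
        have c: "c = c1 + c0" unfolding c_def c0_def c1_def
          by (subst split(1)) (simp add: card_Un_disjoint finI split(2))
        have sums: "smult c f = (\<Sum>T\<in>?F. q T)" "smult c0 f0 = (\<Sum>T\<in>?G0. q T)"
          "smult c1 f1 = (\<Sum>T\<in>?G1. q T)"
          unfolding c_def c0_def c1_def f_def f0_def f1_def
          by (rule card_smult_average; use finI ne Cons.prems(2) in blast)+
        have weight: "(\<Prod>j\<in>E - T. if j = e then \<mu> else 1) = (if e \<in> T then 1 else \<mu>)" for \<mu> :: real and T
          using E(1) Cons.prems(1) by (auto simp: prod.delta)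
        have weighted: "(\<Sum>T\<in>?F. smult (if e \<in> T then 1 else \<mu>) (q T)) = smult c1 f1 +
            smult (\<mu> * c0) f0" for \<mu>
        proof -
          have "(\<Sum>T\<in>?F. smult (if e \<in> T then 1 else \<mu>) (q T)) =
              (\<Sum>T\<in>?G1. smult (if e \<in> T then 1 else \<mu>) (q T)) + (\<Sum>T\<in>?G0.
                  smult (if e \<in> T then 1 else \<mu>) (q T))"
            by (subst split(1)) (rule sum.union_disjoint[OF finI finI split(2)])
          also have "(\<Sum>T\<in>?G1. smult (if e \<in> T then 1 else \<mu>) (q T)) = smult c1 f1"
            unfolding sums by (intro sum.cong) (auto simp: subcube_def)
          also have "(\<Sum>T\<in>?G0. smult (if e \<in> T then 1 else \<mu>) (q T)) = smult \<mu> (smult c0 f0)"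
            unfolding sums smult_sum2 by (intro sum.cong) (auto simp: subcube_def)
          finally show ?thesis by simp
        qed
        have comb: "f = smult (c1 / c) f1 + smult (c0 / c) f0"
        proof -
          have "smult c f = smult c1 f1 + smult c0 f0" using weighted[of 1] sums by simp
          then have "smult (1 / c) (smult c f) = smult (1 / c) (smult c1 f1 + smult c0 f0)" by simp
          then show ?thesis using pos c by (simp add: smult_add_right)
        qed
        have rr: "f1 = 0 \<or> real_rooted_pos f1" "f0 = 0 \<or> real_rooted_pos f0"
          unfolding f1_def f0_def using real_rooted_average ne by auto
        have mix: "f1 + smult \<mu> f0 = 0 \<or> real_rooted (f1 + smult \<mu> f0)" if "\<mu> > 0" for \<mu>
        proof -
          have "smult c1 f1 + smult (\<mu> * c1 / c0 * c0) f0 = smult c1 (f1 + smult \<mu> f0)"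
            using pos by (simp add: smult_add_right mult.commute)
          then have "smult c1 (f1 + smult \<mu> f0) = 0 \<or> real_rooted (smult c1 (f1 + smult \<mu> f0))"
            using stable[of "\<lambda>j. if j = e then \<mu> * c1 / c0 else 1" In Out] pos that
            unfolding weight weighted by simp
          then show ?thesis using pos
            by (auto simp: real_rooted_def of_real_hom.map_poly_hom_smult)
        qed
        have nn: "nonneg_lead f1" "nonneg_lead f0"
          unfolding f1_def f0_def using average_nonneg_lead(1)[OF finI _ nonnegI] ne by auto
        have "ext_degree f = max (ext_degree f1) (ext_degree f0)"
          unfolding comb using nn pos c by (simp add: nonneg_lead_add nonneg_lead_smult)
        moreover have "convex_combination f [f1, f0]"
          unfolding convex_combination_def
          by (rule exI[of _ "\<lambda>i. if i = 0 then c1 / c else c0 / c"])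
             (use pos c comb in \<open>auto simp: less_Suc_eq add_divide_distrib[symmetric]\<close>)
        ultimately show ?thesis
          using common_interlacing_children[OF rr mix] real_rooted_average[OF Cons.prems(2)]
          unfolding 1 tree
          by (auto simp: good_node_def is_leaf_def child_labels_def label_decision_tree
              f_def[symmetric] f0_def[symmetric] f1_def[symmetric])
      qed (use Cons.IH Cons.prems(1) ne in auto)
    qed
  qed
qed

lemma generalized_interlacing_family_of_subcubes:
  assumes E: "finite E" "\<F> \<subseteq> Pow E" "\<F> \<noteq> {}"
    and nonneg: "\<And>T. T \<in> \<F> \<Longrightarrow> nonneg_lead (q T)"
    and stable: "\<And>In Out c. (\<And>j. c j > 0) \<Longrightarrow>
      (\<Sum>T\<in>subcube \<F> In Out. smult (\<Prod>j\<in>E - T. c j) (q T)) = 0 \<or>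
      real_rooted (\<Sum>T\<in>subcube \<F> In Out. smult (\<Prod>j\<in>E - T. c j) (q T))"
  shows "generalized_interlacing_family (q ` \<F>)"
proof -
  obtain es where es: "set es = E" using finite_list[OF E(1)] by blast
  have fin: "finite \<F>" using E finite_subset by blast
  let ?t = "decision_tree q es \<F>"
  have leaves: "leaf_labels ?t = q ` \<F>"
    by (rule leaf_labels_decision_tree[OF fin E(3)]) (use E(2) es in blast)
  have whole: "subcube \<F> {} {} = \<F>" by (auto simp: subcube_def)
  have good: "good_node v" if "v \<in> nodes ?t" for v
  proof (rule good_nodes_decision_tree[OF E(1) _ fin _ nonneg stable])
    show "set es \<subseteq> E" using es by simp
    show "subcube \<F> {} {} \<noteq> {}" using E(3) whole by simp
    show "v \<in> nodes (decision_tree q es (subcube \<F> {} {}))" using that whole by simp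
  qed
  have "ext_degree (label ?t) = Max (ext_degree ` leaf_labels ?t)"
    unfolding leaves label_decision_tree using average_nonneg_lead(2)[OF fin E(3) nonneg] .
  then have "generalized_interlacing_tree ?t"
    using good unfolding generalized_interlacing_tree_def good_node_def by metis
  then show ?thesis unfolding generalized_interlacing_family_def using leaves by metis
qed

section \<open>Minors with prescribed numbers of rows and columns\<close>

text \<open>
A member of a subcube is determined by its free parts \<open>S\<close> and \<open>W\<close>, whose sizes are what the
decisions \<open>In\<close> leave over from \<open>k\<close>.
\<close>

lemma subcube_sum:
  fixes h :: "'i set \<Rightarrow> 'b::comm_monoid_add"
  assumes fin: "finite R1" "finite R2" and disj: "R1 \<inter> R2 = {}"
    and In: "In \<subseteq> R1 \<union> R2" "In \<inter> Out = {}"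
    and \<F>: "\<F> = {T. T \<subseteq> R1 \<union> R2 \<and> card (T \<inter> R1) = k \<and> card (T \<inter> R2) = k}"
    and J: "J1 = R1 - In - Out" "J2 = R2 - In - Out"
    and k: "k = card (In \<inter> R1) + k1" "k = card (In \<inter> R2) + k2"
  shows "(\<Sum>T\<in>subcube \<F> In Out. h T) =
    (\<Sum>S | S \<subseteq> J1 \<and> card S = k1. \<Sum>W | W \<subseteq> J2 \<and> card W = k2. h (In \<union> S \<union> W))"
proof -
  let ?\<S> = "{S. S \<subseteq> J1 \<and> card S = k1}" and ?\<W> = "{W. W \<subseteq> J2 \<and> card W = k2}"
  have fin\<S>: "finite ?\<S>" "finite ?\<W>"
    using fin unfolding J by (auto intro: finite_subset[of _ "Pow R1"] finite_subset[of _ "Pow R2"])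
  have card_split: "card ((In \<union> S \<union> W) \<inter> R1) = card (In \<inter> R1) + card S"
    "card ((In \<union> S \<union> W) \<inter> R2) = card (In \<inter> R2) + card W" if "S \<subseteq> J1" "W \<subseteq> J2" for S W
  proof -
    have "(In \<union> S \<union> W) \<inter> R1 = (In \<inter> R1) \<union> S" "(In \<union> S \<union> W) \<inter> R2 = (In \<inter> R2) \<union> W"
      "(In \<inter> R1) \<inter> S = {}" "(In \<inter> R2) \<inter> W = {}" "S \<subseteq> R1" "W \<subseteq> R2"
      using that disj unfolding J by auto
    then show "card ((In \<union> S \<union> W) \<inter> R1) = card (In \<inter> R1) + card S"
      "card ((In \<union> S \<union> W) \<inter> R2) = card (In \<inter> R2) + card W"
      using fin by (auto simp: card_Un_disjoint finite_subset)
  qed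
  have join: "In \<union> (T \<inter> J1) \<union> (T \<inter> J2) = T" if "T \<in> subcube \<F> In Out" for T
    using that unfolding subcube_def \<F> J by auto
  have "(\<Sum>T\<in>subcube \<F> In Out. h T) = (\<Sum>(S, W)\<in>?\<S> \<times> ?\<W>. h (In \<union> S \<union> W))"
  proof (rule sum.reindex_bij_witness[of _ "\<lambda>(S, W). In \<union> S \<union> W" "\<lambda>T. (T \<inter> J1, T \<inter> J2)"])
    fix T assume T: "T \<in> subcube \<F> In Out"
    show "(\<lambda>(S, W). In \<union> S \<union> W) (T \<inter> J1, T \<inter> J2) = T" using join[OF T] by simp
    show "(case (T \<inter> J1, T \<inter> J2) of (S, W) \<Rightarrow> h (In \<union> S \<union> W)) = h T" using join[OF T] by simp
    have "card (T \<inter> J1) = k1" "card (T \<inter> J2) = k2"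
      using card_split[of "T \<inter> J1" "T \<inter> J2"] T k unfolding join[OF T] subcube_def \<F> by auto
    then show "(T \<inter> J1, T \<inter> J2) \<in> ?\<S> \<times> ?\<W>" by auto
  next
    fix SW assume SW: "SW \<in> ?\<S> \<times> ?\<W>"
    obtain S W where eq: "SW = (S, W)" by (cases SW)
    have S: "S \<subseteq> J1" "card S = k1" and W: "W \<subseteq> J2" "card W = k2" using SW eq by auto
    have "(In \<union> S \<union> W) \<inter> J1 = S" "(In \<union> S \<union> W) \<inter> J2 = W"
      using S W In disj unfolding J by auto
    then show "((case SW of (S, W) \<Rightarrow> In \<union> S \<union> W) \<inter> J1, (case SW of (S, W) \<Rightarrow> In \<union> S \<union> W) \<inter> J2) = SW"
      by (simp add: eq)
    show "(case SW of (S, W) \<Rightarrow> In \<union> S \<union> W) \<in> subcube \<F> In Out"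
      using S W In card_split[of S W] k unfolding eq subcube_def \<F> J by auto
  qed
  also have "\<dots> = (\<Sum>S\<in>?\<S>. \<Sum>W\<in>?\<W>. h (In \<union> S \<union> W))"
    by (simp add: sum.cartesian_product)
  finally show ?thesis .
qed

text \<open>
Both hypotheses of the criterion hold for the minors of a saddle-point pencil. The sign
\<open>(-1) ^ (k + card X)\<close> is the one of \<open>sign_index_det_saddle\<close>. In the weights, the indices in
\<open>Out\<close> are missing from every member, so they contribute the common factor \<open>\<kappa>\<close>, and the other missing
indices are those of \<open>weighted_minors_real_rooted\<close>.
\<close>

lemma generalized_interlacing_family_minors:
  fixes M :: "'i \<Rightarrow> 'i \<Rightarrow> real"
  assumes fin: "finite B" "finite R1" "finite R2" "finite X"
    and disj: "B \<inter> (R1 \<union> R2 \<union> X) = {}" "R1 \<inter> R2 = {}" "(R1 \<union> R2) \<inter> X = {}"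
    and symm: "\<And>i j. M i j = M j i"
    and pos: "\<And>i j. i \<in> B \<union> R1 \<Longrightarrow> j \<in> B \<union> R1 \<Longrightarrow> M i j = (if i = j \<and> i \<in> B then 1 else 0)"
    and neg: "\<And>i j. i \<in> R2 \<union> X \<Longrightarrow> j \<in> R2 \<union> X \<Longrightarrow> M i j = 0"
    and k: "k \<le> card R1" "k \<le> card R2"
  defines "\<F> \<equiv> {T. T \<subseteq> R1 \<union> R2 \<and> card (T \<inter> R1) = k \<and> card (T \<inter> R2) = k}"
    and "q \<equiv> (\<lambda>T. smult ((-1) ^ (k + card X)) (index_det (B \<union> T \<union> X) (minor_pencil M X)))"
  shows "generalized_interlacing_family (q ` \<F>)"
proof (rule generalized_interlacing_family_of_subcubes)
  show "finite (R1 \<union> R2)" using fin by simp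
  show "\<F> \<subseteq> Pow (R1 \<union> R2)" by (auto simp: \<F>_def)
  obtain S W where SW: "S \<subseteq> R1" "card S = k" "W \<subseteq> R2" "card W = k"
    using obtain_subset_with_card_n[OF k(1)] obtain_subset_with_card_n[OF k(2)] by metis
  then have "(S \<union> W) \<inter> R1 = S" "(S \<union> W) \<inter> R2 = W" using disj by auto
  then have "S \<union> W \<in> \<F>" using SW by (auto simp: \<F>_def)
  then show "\<F> \<noteq> {}" by blast
next
  fix T assume T: "T \<in> \<F>"
  show "nonneg_lead (q T)"
  proof (rule nonneg_leadI)
    fix x :: real assume x: "x > 0"
    let ?K = "\<lambda>i j. poly (minor_pencil M X i j) x"
    have K: "?K i j = M i j - (if i = j \<and> i \<in> X then x else 0)" for i j
      by (auto simp: minor_pencil_def)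
    have "card (T \<inter> R2 \<union> X) = k + card X"
      using T fin disj by (subst card_Un_disjoint) (auto simp: \<F>_def)
    moreover have "B \<union> T \<union> X = (B \<union> T \<inter> R1) \<union> (T \<inter> R2 \<union> X)" using T by (auto simp: \<F>_def)
    moreover have "(-1) ^ card (T \<inter> R2 \<union> X) * index_det ((B \<union> T \<inter> R1) \<union> (T \<inter> R2 \<union> X)) ?K \<ge> 0"
    proof (rule sign_index_det_saddle)
      show "?K i j = ?K j i" for i j unfolding K using symm[of i j] by auto
      show "?K i j = 0" if "i \<in> B \<union> T \<inter> R1" "j \<in> B \<union> T \<inter> R1" "i \<noteq> j" for i j
        unfolding K using that pos[of i j] by auto
      show "?K i i \<ge> 0" if "i \<in> B \<union> T \<inter> R1" for i
        unfolding K using that pos[of i i] disj by auto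
      show "?K i j = 0" if "i \<in> T \<inter> R2 \<union> X" "j \<in> T \<inter> R2 \<union> X" "i \<noteq> j" for i j
        unfolding K using that neg[of i j] by auto
      show "?K i i \<le> 0" if "i \<in> T \<inter> R2 \<union> X" for i
        unfolding K using that neg[of i i] x by auto
    qed (use fin disj in auto)
    ultimately show "poly (q T) x \<ge> 0" by (simp add: q_def poly_index_det)
  qed
next
  fix In Out :: "'i set" and c :: "'i \<Rightarrow> real"
  assume c: "\<And>j. c j > 0"
  let ?E = "R1 \<union> R2"
  let ?sum = "\<Sum>T\<in>subcube \<F> In Out. smult (\<Prod>j\<in>?E - T. c j) (q T)"
  show "?sum = 0 \<or> real_rooted ?sum"
  proof (cases "subcube \<F> In Out = {}")
    case False
    then obtain T where T: "T \<in> \<F>" "In \<subseteq> T" "T \<inter> Out = {}" by (auto simp: subcube_def)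
    then have In: "In \<subseteq> R1 \<union> R2" "In \<inter> Out = {}" by (auto simp: \<F>_def)
    define J1 J2 where J: "J1 = R1 - In - Out" "J2 = R2 - In - Out"
    have finJ: "finite J1" "finite J2" using fin J by auto
    have finI: "finite In" using In fin finite_subset by blast
    define k1 k2 where "k1 = card (T \<inter> J1)" and "k2 = card (T \<inter> J2)"
    have kk: "k = card (In \<inter> R1) + k1" "k = card (In \<inter> R2) + k2"
    proof -
      have "T \<inter> R1 = (In \<inter> R1) \<union> (T \<inter> J1)" "T \<inter> R2 = (In \<inter> R2) \<union> (T \<inter> J2)"
        "(In \<inter> R1) \<inter> (T \<inter> J1) = {}" "(In \<inter> R2) \<inter> (T \<inter> J2) = {}"
        using T J by auto
      then have "card (T \<inter> R1) = card (In \<inter> R1) + k1" "card (T \<inter> R2) = card (In \<inter> R2) + k2"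
        using finI finJ by (simp_all add: k1_def k2_def card_Un_disjoint)
      then show "k = card (In \<inter> R1) + k1" "k = card (In \<inter> R2) + k2" using T by (simp_all add: \<F>_def)
    qed
    have k12: "k1 \<le> card J1" "k2 \<le> card J2" unfolding k1_def k2_def using finJ by (auto intro: card_mono)
    have co: "S \<subseteq> J \<and> card S = l \<longleftrightarrow> S \<subseteq> J \<and> card (J - S) = card J - l" if "finite J" "l \<le> card J"
        for S J :: "'i set" and l
      using that card_mono[of J S] by (auto simp: card_Diff_subset finite_subset)
    define \<kappa> where "\<kappa> = (\<Prod>j\<in>?E \<inter> Out. c j)"
    have \<kappa>: "\<kappa> > 0" unfolding \<kappa>_def by (intro prod_pos) (use c in auto)
    define p where "p = (\<Sum>S | S \<subseteq> J1 \<and> card (J1 - S) = card J1 - k1. \<Sum>W | W \<subseteq> J2 \<and> card (J2 - W) =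
        card J2 - k2.
      smult ((\<Prod>j\<in>J1 - S. c j) * (\<Prod>j\<in>J2 - W. c j)) (index_det (B \<union> In \<union> X \<union> S \<union> W) (minor_pencil M X)))"
    have "p = 0 \<or> real_rooted p"
      unfolding p_def
      by (rule weighted_minors_real_rooted)
         (use fin finJ finI disj In J c symm pos in \<open>auto\<close>)
    moreover have "?sum = smult (\<kappa> * (-1) ^ (k + card X)) p"
    proof -
      have "?sum = (\<Sum>S | S \<subseteq> J1 \<and> card S = k1. \<Sum>W | W \<subseteq> J2 \<and> card W = k2.
          smult (\<Prod>j\<in>?E - (In \<union> S \<union> W). c j) (q (In \<union> S \<union> W)))"
        by (rule subcube_sum[OF fin(2,3) disj(2) In \<F>_def[THEN meta_eq_to_obj_eq] J kk])
      also have "\<dots> = (\<Sum>S | S \<subseteq> J1 \<and> card S = k1. \<Sum>W | W \<subseteq> J2 \<and> card W = k2.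
          smult (\<kappa> * (-1) ^ (k + card X)) (smult ((\<Prod>j\<in>J1 - S. c j) * (\<Prod>j\<in>J2 - W. c j))
            (index_det (B \<union> In \<union> X \<union> S \<union> W) (minor_pencil M X))))"
      proof (intro sum.cong refl)
        fix S W assume "S \<in> {S. S \<subseteq> J1 \<and> card S = k1}" "W \<in> {W. W \<subseteq> J2 \<and> card W = k2}"
        then have SW: "S \<subseteq> J1" "W \<subseteq> J2" by auto
        have "?E - (In \<union> S \<union> W) = (?E \<inter> Out) \<union> ((J1 - S) \<union> (J2 - W))"
          using SW J In disj(2) by auto
        moreover have "(?E \<inter> Out) \<inter> ((J1 - S) \<union> (J2 - W)) = {}" "(J1 - S) \<inter> (J2 - W) = {}"
          using J disj(2) by auto
        ultimately have "(\<Prod>j\<in>?E - (In \<union> S \<union> W). c j) = \<kappa> * ((\<Prod>j\<in>J1 - S. c j) * (\<Prod>j\<in>J2 - W. c j))"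
          using fin finJ by (simp add: prod.union_disjoint \<kappa>_def)
        moreover have "B \<union> (In \<union> S \<union> W) \<union> X = B \<union> In \<union> X \<union> S \<union> W" by auto
        ultimately show "smult (\<Prod>j\<in>?E - (In \<union> S \<union> W). c j) (q (In \<union> S \<union> W)) =
            smult (\<kappa> * (-1) ^ (k + card X)) (smult ((\<Prod>j\<in>J1 - S. c j) * (\<Prod>j\<in>J2 - W. c j))
            (index_det (B \<union> In \<union> X \<union> S \<union> W) (minor_pencil M X)))"
          by (simp add: q_def mult_ac)
      qed
      also have "\<dots> = smult (\<kappa> * (-1) ^ (k + card X)) p"
        unfolding p_def smult_sum2 co[OF finJ(1) k12(1)] co[OF finJ(2) k12(2)] ..
      finally show ?thesis .
    qed
    ultimately show ?thesis using \<kappa> by (auto simp: real_rooted_def of_real_hom.map_poly_hom_smult)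
  qed simp
qed

lemma image_setcompr2:
  "q ` {g S W | S W. P S \<and> Q W} = {q (g S W) | S W. P S \<and> Q W}"
  by blast

section \<open>The block matrices as principal submatrices\<close>

datatype index = Ident nat | Row nat | Col nat | Var nat

text \<open>
The symmetric matrix whose principal submatrices are, up to the term \<open>- x\<close> on the last diagonal
block, all the block matrices at once; the index types are the four blocks.
\<close>

fun entry :: "real mat \<Rightarrow> real mat \<Rightarrow> real mat \<Rightarrow> real mat \<Rightarrow> index \<Rightarrow> index \<Rightarrow> real" where
  "entry A C U R (Ident i) (Ident j) = (if i = j then 1 else 0)"
| "entry A C U R (Ident i) (Col j) = C $$ (i, j)"
| "entry A C U R (Ident i) (Var j) = A $$ (i, j)"
| "entry A C U R (Row i) (Col j) = U $$ (i, j)"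
| "entry A C U R (Row i) (Var j) = R $$ (i, j)"
| "entry A C U R (Col i) (Ident j) = C $$ (j, i)"
| "entry A C U R (Var i) (Ident j) = A $$ (j, i)"
| "entry A C U R (Col i) (Row j) = U $$ (j, i)"
| "entry A C U R (Var i) (Row j) = R $$ (j, i)"
| "entry A C U R _ _ = 0"

lemma entry_symmetric: "entry A C U R a b = entry A C U R b a"
  by (cases a; cases b) auto

text \<open>
The enumeration \<open>f\<close> walks through the four blocks in order and uses \<open>pick\<close>, which is how
submatrices are indexed, inside \<open>S\<close> and \<open>W\<close>.
\<close>

lemma det_block_matrix:
  assumes A: "A \<in> carrier_mat n d" and C: "C \<in> carrier_mat n dC"
    and U: "U \<in> carrier_mat nR dC" and R: "R \<in> carrier_mat nR d"
    and S: "S \<subseteq> {0..<nR}" "card S = k" and W: "W \<subseteq> {0..<dC}" "card W = k"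
  shows "det (block_matrix A C U R S W) =
    index_det (Ident ` {0..<n} \<union> Row ` S \<union> Col ` W \<union> Var ` {0..<d}) (minor_pencil (entry A C U R)
        (Var ` {0..<d}))"
    (is "_ = index_det ?T ?M")
proof -
  define f where "f i = (if i < n then Ident i else if i < n + k then Row (pick S (i - n))
    else if i < n + k + k then Col (pick W (i - n - k)) else Var (i - n - k - k))" for i
  have cardS: "card {i. i < nR \<and> i \<in> S} = k" "card {i. i < dC \<and> i \<in> W} = k"
  proof -
    have "{i. i < nR \<and> i \<in> S} = S" "{i. i < dC \<and> i \<in> W} = W" using S W by auto
    then show "card {i. i < nR \<and> i \<in> S} = k" "card {i. i < dC \<and> i \<in> W} = k" using S W by simp_all
  qed
  have pickS: "pick S i \<in> S" "pick W i \<in> W" if "i < k" for i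
    using that S W by (auto intro: pick_in_set_le)
  have inj_pick: "pick S i = pick S j \<longleftrightarrow> i = j" "pick W i = pick W j \<longleftrightarrow> i = j" if "i < k" "j < k" for i j
    using that S W pick_mono_le[of i S j] pick_mono_le[of j S i] pick_mono_le[of i W j]
        pick_mono_le[of j W i]
    by (cases i j rule: linorder_cases; simp)+
  have finT: "finite ?T" using finite_subset[OF S(1)] finite_subset[OF W(1)] by auto
  have cardT: "card ?T = n + k + k + d"
  proof -
    have fin: "finite S" "finite W" using S W finite_subset by blast+
    have "card ?T = card (Ident ` {0..<n}) + card (Row ` S) + card (Col ` W) + card (Var ` {0..<d})"
      using fin by (subst card_Un_disjoint; auto)+
    then show ?thesis using S W by (simp add: card_image inj_on_def)
  qed
  have inj: "inj_on f {0..<n + k + k + d}"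
    by (rule inj_onI) (auto simp: f_def inj_pick split: if_splits)
  have "f ` {0..<n + k + k + d} \<subseteq> ?T"
    using pickS by (auto simp: f_def)
  then have "f ` {0..<n + k + k + d} = ?T"
    by (rule card_subset_eq[OF finT]) (simp add: card_image[OF inj] cardT)
  then have bij: "bij_betw f {0..<n + k + k + d} ?T"
    unfolding bij_betw_def using inj by blast
  have sub: "submatrix C UNIV W \<in> carrier_mat n k" "submatrix U S W \<in> carrier_mat k k"
    "submatrix R S UNIV \<in> carrier_mat k d"
    using C U R cardS by (auto simp: dim_submatrix)
  have subC: "submatrix C UNIV W $$ (i, j) = C $$ (i, pick W j)" if "i < n" "j < k" for i j
    using that C cardS by (subst submatrix_index) (auto simp: pick_UNIV)
  have subU: "submatrix U S W $$ (i, j) = U $$ (pick S i, pick W j)" if "i < k" "j < k" for i j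
    using that U cardS by (subst submatrix_index) auto
  have subR: "submatrix R S UNIV $$ (i, j) = R $$ (pick S i, j)" if "i < k" "j < d" for i j
    using that R cardS by (subst submatrix_index) (auto simp: pick_UNIV)
  have "block_matrix A C U R S W = mat (n + k + k + d) (n + k + k + d) (\<lambda>(i, j). ?M (f i) (f j))"
  proof (rule eq_matI)
    fix i j
    assume "i < dim_row (mat (n + k + k + d) (n + k + k + d) (\<lambda>(i, j). ?M (f i) (f j)))"
      and "j < dim_col (mat (n + k + k + d) (n + k + k + d) (\<lambda>(i, j). ?M (f i) (f j)))"
    then have ij: "i < n + k + k + d" "j < n + k + k + d" by auto
    have f_block: "f l = Ident l" if "l < n" for l using that by (simp add: f_def)
    have f_block': "f (n + l) = Row (pick S l)" "f (n + k + l) = Col (pick W l)" if "l < k" for l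
      using that by (simp_all add: f_def)
    have f_block'': "f (n + k + k + l) = Var l" for l by (simp add: f_def)
    have block: "l < n \<or> (\<exists>m<k. l = n + m) \<or> (\<exists>m<k. l = n + k + m) \<or> (\<exists>m<d. l = n + k + k + m)"
      if "l < n + k + k + d" for l
      using that by presburger
    have dims: "dim_row A = n" "dim_col A = d" "card S = k" using A S by auto
    note sdims = carrier_matD[OF sub(1)] carrier_matD[OF sub(2)] carrier_matD[OF sub(3)]
    note defs = block_matrix_def Let_def const_mat_def
    have "block_matrix A C U R S W $$ (i, j) = ?M (f i) (f j)"
    proof (use block[OF ij(1)] in \<open>elim disjE exE conjE\<close>)
      assume i: "i < n"
      show ?thesis
        using i block[OF ij(2)]
        by (elim disjE exE conjE)
           (simp_all add: defs image_iff minor_pencil_def dims sdims f_block f_block' f_block'' subC)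
    next
      fix a assume i: "i = n + a" "a < k"
      show ?thesis
        using i block[OF ij(2)]
        by (elim disjE exE conjE)
           (simp_all add: defs image_iff minor_pencil_def dims sdims f_block f_block' f_block''
               subU subR)
    next
      fix a assume i: "i = n + k + a" "a < k"
      show ?thesis
        using i block[OF ij(2)]
        by (elim disjE exE conjE)
           (simp_all add: defs image_iff minor_pencil_def dims sdims f_block f_block' f_block''
               subC subU)
    next
      fix a assume i: "i = n + k + k + a" "a < d"
      show ?thesis
        using i block[OF ij(2)]
        by (elim disjE exE conjE)
           (simp_all add: defs image_iff minor_pencil_def dims sdims f_block f_block' f_block''
               subR one_pCons)
    qed
    then show "block_matrix A C U R S W $$ (i, j) =
        mat (n + k + k + d) (n + k + k + d) (\<lambda>(i, j). ?M (f i) (f j)) $$ (i, j)"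
      using ij by simp
  qed (use A sub S(2) in \<open>auto simp: block_matrix_def Let_def const_mat_def\<close>)
  then show ?thesis using det_mat_eq_index_det[OF bij, of ?M] by simp
qed


lemma p_poly_eq_index_det:
  assumes "A \<in> carrier_mat n d" "C \<in> carrier_mat n dC" "U \<in> carrier_mat nR dC" "R \<in> carrier_mat nR d"
    and "S \<in> k_subsets nR k" "W \<in> k_subsets dC k"
  shows "p_poly A C U R S W = smult ((-1) ^ (k + d))
    (index_det (Ident ` {0..<n} \<union> (Row ` S \<union> Col ` W) \<union> Var ` {0..<d})
      (minor_pencil (entry A C U R) (Var ` {0..<d})))"
proof -
  have "(-1) powi (int d - int k) = ((-1) ^ (k + d) :: real)"
    by (cases "even k"; cases "even d") (simp_all add: power_int_diff)
  then show ?thesis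
    using assms det_block_matrix[of A n d C dC U nR R S k W]
    by (simp add: p_poly_def k_subsets_def Un_assoc)
qed

lemma index_subsets_iff:
  "(T \<subseteq> Row ` {0..<m} \<union> Col ` {0..<l} \<and> card (T \<inter> Row ` {0..<m}) = k \<and> card (T \<inter> Col ` {0..<l}) = k) \<longleftrightarrow>
    (\<exists>S W. T = Row ` S \<union> Col ` W \<and> S \<in> k_subsets m k \<and> W \<in> k_subsets l k)"
    (is "?lhs \<longleftrightarrow> ?rhs")
proof
  assume lhs: ?lhs
  let ?S = "{i. Row i \<in> T}" and ?W = "{j. Col j \<in> T}"
  have "T = Row ` ?S \<union> Col ` ?W" using lhs by auto
  moreover have "Row ` ?S = T \<inter> Row ` {0..<m}" "Col ` ?W = T \<inter> Col ` {0..<l}" using lhs by auto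
  then have "card ?S = k" "card ?W = k"
    using lhs card_image[of Row ?S] card_image[of Col ?W] by (simp_all add: inj_on_def)
  moreover have "?S \<subseteq> {0..<m}" "?W \<subseteq> {0..<l}" using lhs by auto
  ultimately show ?rhs unfolding k_subsets_def by blast
next
  assume ?rhs
  then obtain S W where SW: "T = Row ` S \<union> Col ` W" "S \<in> k_subsets m k" "W \<in> k_subsets l k" by blast
  have "T \<inter> Row ` {0..<m} = Row ` S" "T \<inter> Col ` {0..<l} = Col ` W"
    using SW by (auto simp: k_subsets_def)
  then show ?lhs using SW by (auto simp: k_subsets_def card_image inj_on_def)
qed

lemma (in vec_space) rank_le_nr:
  assumes "A \<in> carrier_mat n nc"
  shows "rank A \<le> n"
proof -
  obtain S where S: "maximal S (\<lambda>T. T \<subseteq> set (cols A) \<and> lin_indpt T)"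
    using maximal_exists[of "(\<lambda>T. T \<subseteq> set (cols A) \<and> lin_indpt T)" "card (set (cols A))" "{}"]
    by (meson List.finite_set card_mono empty_iff empty_subsetI finite_lin_indpt2 rev_finite_subset)
  then have "S \<subseteq> carrier_vec n" "lin_indpt S"
    using cols_dim[of A] assms unfolding maximal_def by auto
  then have "card S \<le> n" using li_le_dim(2)[OF fin_dim] dim_is_n by simp
  then show ?thesis using rank_card_indpt[OF assms S] by simp
qed

theorem lemma5p4:
  fixes A C U R :: "real mat" and n d n\<^sub>R d\<^sub>C k :: nat
  assumes "A \<in> carrier_mat n d" and "C \<in> carrier_mat n d\<^sub>C"
    and "U \<in> carrier_mat n\<^sub>R d\<^sub>C" and "R \<in> carrier_mat n\<^sub>R d"
    and "k \<le> vec_space.rank n\<^sub>R U"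
  shows "generalized_interlacing_family
           {p_poly A C U R S W | S W. S \<in> k_subsets n\<^sub>R k \<and> W \<in> k_subsets d\<^sub>C k}"
proof -
  let ?M = "entry A C U R" and ?B = "Ident ` {0..<n}" and ?X = "Var ` {0..<d}"
  let ?R1 = "Row ` {0..<n\<^sub>R}" and ?R2 = "Col ` {0..<d\<^sub>C}"
  let ?\<F> = "{T. T \<subseteq> ?R1 \<union> ?R2 \<and> card (T \<inter> ?R1) = k \<and> card (T \<inter> ?R2) = k}"
  define q where "q = (\<lambda>T. smult ((-1) ^ (k + card ?X)) (index_det (?B \<union> T \<union> ?X) (minor_pencil ?M ?X)))"
  have cards: "card ?X = d" "card ?R1 = n\<^sub>R" "card ?R2 = d\<^sub>C"
    by (simp_all add: card_image inj_on_def)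
  have k: "k \<le> n\<^sub>R" "k \<le> d\<^sub>C"
    using assms(5) vec_space.rank_le_nr[OF assms(3)] vec_space.rank_le_nc[OF assms(3)] by linarith+
  have q_eq: "q (Row ` S \<union> Col ` W) = p_poly A C U R S W"
    if "S \<in> k_subsets n\<^sub>R k" "W \<in> k_subsets d\<^sub>C k" for S W
    using p_poly_eq_index_det[OF assms(1-4) that] cards by (simp add: q_def)
  have "?\<F> = {Row ` S \<union> Col ` W | S W. S \<in> k_subsets n\<^sub>R k \<and> W \<in> k_subsets d\<^sub>C k}"
    by (rule Collect_cong) (rule index_subsets_iff)
  then have "q ` ?\<F> = q ` {Row ` S \<union> Col ` W | S W. S \<in> k_subsets n\<^sub>R k \<and> W \<in> k_subsets d\<^sub>C k}"
    by (rule arg_cong)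
  also have "\<dots> = {q (Row ` S \<union> Col ` W) | S W. S \<in> k_subsets n\<^sub>R k \<and> W \<in> k_subsets d\<^sub>C k}"
    by (rule image_setcompr2)
  also have "\<dots> = {p_poly A C U R S W | S W. S \<in> k_subsets n\<^sub>R k \<and> W \<in> k_subsets d\<^sub>C k}"
    using q_eq by (intro Collect_cong) metis
  finally have "{p_poly A C U R S W | S W. S \<in> k_subsets n\<^sub>R k \<and> W \<in> k_subsets d\<^sub>C k} = q ` ?\<F>" ..
  moreover have "generalized_interlacing_family (q ` ?\<F>)"
    unfolding q_def
    by (rule generalized_interlacing_family_minors) (use k cards in \<open>auto intro: entry_symmetric
        split: if_splits\<close>)
  ultimately show ?thesis by simp
qed

end
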